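(* Let $G$ be one of $\mathrm{GL}_{2n},\mathrm{SL}_{2n},\mathrm{GO}_{2n},\mathrm{O}_{2n},\mathrm{GSp}_{2n},\mathrm{Sp}_{2n}$ over $\mathbb F_q$, with Siegel parabolic subgroup $P$. Fix a character $\chi\colon P\to\mathbb C^\times$, written as $\chi=(\alpha\circ m)(\beta\circ\chi_{\det})$ with characters $\alpha,\beta\colon\mathbb F_q^\times\to\mathbb C^\times$. Then the dimension of $\operatorname{End}_G\operatorname{Ind}_P^G\chi$ equals $$\begin{cases} n+1&\text{if }\beta=1,\\ 2&\text{if }\beta^2=1,\ \beta\ne1\text{ and }G=\mathrm{SL}_{2n},\\ n+1&\text{if }\beta^2=1,\ \beta\ne1\text{ and }G\in\{\mathrm{O}_{2n},\mathrm{Sp}_{2n}\},\\ \left\lfloor\frac12(n+2)\right\rfloor&\text{if }\beta^2=1,\ \beta\ne1\text{ and }G\in\{\mathrm{GO}_{2n},\mathrm{GSp}_{2n}\},\\ 1&\text{else}. \end{cases}$$ In particular, $\operatorname{Ind}_P^G\chi$ is irreducible provided $\beta^2\ne1$.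
   Context: $q$ is an odd prime power with $3\nmid q$, and $n\ge1$. Set $\varepsilon=+1$ if $G\in\{\mathrm{GO}_{2n},\mathrm{O}_{2n}\}$ and $\varepsilon=-1$ otherwise, and $J=\begin{bmatrix}0&\varepsilon1_n\\1_n&0\end{bmatrix}$. The groups $\mathrm{GO}_{2n}$ (with $\varepsilon=1$) and $\mathrm{GSp}_{2n}$ (with $\varepsilon=-1$) consist of $g\in\mathrm{GL}_{2n}(\mathbb F_q)$ with $g^\intercal Jg=\lambda J$ for some $\lambda\in\mathbb F_q^\times$; $\mathrm{O}_{2n}$ and $\mathrm{Sp}_{2n}$ are the subgroups with $\lambda=1$. $P=\left\{\begin{bmatrix}A&B\\0&D\end{bmatrix}\in G\right\}$ with $n\times n$ blocks. $\chi_{\det}\colon P\to\mathbb F_q^\times$ is $\begin{bmatrix}A&B\\0&D\end{bmatrix}\mapsto(\det D)^{-1}$. The multiplier $m\colon P\to\mathbb F_q^\times$ is: $m\left(\begin{bmatrix}A&B\\0&D\end{bmatrix}\right)=\det(AD)$ if $G=\mathrm{GL}_{2n}$; $m\left(\begin{bmatrix}\lambda A&B\\0&A^{-\intercal}\end{bmatrix}\right)=\lambda$ if $G\in\{\mathrm{GO}_{2n},\mathrm{GSp}_{2n}\}$; trivial otherwise. (Every character of $P$ has the form $(\alpha\circ m)(\beta\circ\chi_{\det})$.) $\operatorname{Ind}_P^G\chi$ is the space of functions $f\colon G\to\mathbb C$ with $f(pg)=\chi(p)f(g)$ for $p\in P$, $g\in G$, with $G$ acting by right translation. *)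

theory Defs
  imports
    "Jordan_Normal_Form.Determinant"
    "HOL-Algebra.Group"
    "HOL-Library.Function_Algebras"
    "HOL-Library.Cardinality"
begin

text \<open>\<open>Ort\<close> is the orthogonal family; the name \<open>O\<close> is taken by relation composition.\<close>

datatype group_family = GL | SL | GO | Ort | GSp | Sp

definition eps :: "group_family \<Rightarrow> 'a::field" where
  "eps X = (if X \<in> {GO, Ort} then 1 else - 1)"

definition J_mat :: "group_family \<Rightarrow> nat \<Rightarrow> 'a::field mat" where
  "J_mat X n = four_block_mat (0\<^sub>m n n) (eps X \<cdot>\<^sub>m 1\<^sub>m n) (1\<^sub>m n) (0\<^sub>m n n)"

definition GL_set :: "nat \<Rightarrow> 'a::field mat set" where
  "GL_set k = {g \<in> carrier_mat k k. invertible_mat g}"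

text \<open>The parameter \<open>n\<close> is half the matrix size throughout.\<close>

fun G_set :: "group_family \<Rightarrow> nat \<Rightarrow> 'a::field mat set" where
  "G_set GL n = GL_set (2 * n)"
| "G_set SL n = {g \<in> GL_set (2 * n). det g = 1}"
| "G_set GO n = {g \<in> GL_set (2 * n).
     \<exists>l. l \<noteq> 0 \<and> transpose_mat g * J_mat GO n * g = l \<cdot>\<^sub>m J_mat GO n}"
| "G_set Ort n = {g \<in> GL_set (2 * n). transpose_mat g * J_mat Ort n * g = J_mat Ort n}"
| "G_set GSp n = {g \<in> GL_set (2 * n).
     \<exists>l. l \<noteq> 0 \<and> transpose_mat g * J_mat GSp n * g = l \<cdot>\<^sub>m J_mat GSp n}"
| "G_set Sp n = {g \<in> GL_set (2 * n). transpose_mat g * J_mat Sp n * g = J_mat Sp n}"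

definition G_grp :: "group_family \<Rightarrow> nat \<Rightarrow> 'a::field mat monoid" where
  "G_grp X n = \<lparr>carrier = G_set X n, mult = (*), one = 1\<^sub>m (2 * n)\<rparr>"

definition P_set :: "group_family \<Rightarrow> nat \<Rightarrow> 'a::field mat set" where
  "P_set X n = {g \<in> G_set X n. \<exists>A \<in> carrier_mat n n. \<exists>B \<in> carrier_mat n n. \<exists>D \<in> carrier_mat n n.
     g = four_block_mat A B (0\<^sub>m n n) D}"

definition P_grp :: "group_family \<Rightarrow> nat \<Rightarrow> 'a::field mat monoid" where
  "P_grp X n = (G_grp X n)\<lparr>carrier := P_set X n\<rparr>"

definition chi_det :: "nat \<Rightarrow> 'a::field mat \<Rightarrow> 'a" where
  "chi_det n g = (case split_block g n n of (A, B, C, D) \<Rightarrow> inverse (det D))"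

text \<open>The scalar is unique for \<open>n \<ge> 1\<close>: the block \<open>D\<close> is the inverse transpose of \<open>A\<close>,
  so \<open>g\<close> determines \<open>A\<close>, and \<open>A \<noteq> 0\<close>.\<close>

definition similitude :: "nat \<Rightarrow> 'a::field mat \<Rightarrow> 'a" where
  "similitude n g = (THE l. l \<noteq> 0 \<and>
     (\<exists>A \<in> carrier_mat n n. \<exists>B \<in> carrier_mat n n. \<exists>D \<in> carrier_mat n n.
        inverts_mat (transpose_mat A) D \<and> inverts_mat D (transpose_mat A) \<and>
        g = four_block_mat (l \<cdot>\<^sub>m A) B (0\<^sub>m n n) D))"

fun multiplier :: "group_family \<Rightarrow> nat \<Rightarrow> 'a::field mat \<Rightarrow> 'a" where
  "multiplier GL n g = (case split_block g n n of (A, B, C, D) \<Rightarrow> det (A * D))"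
| "multiplier GO n g = similitude n g"
| "multiplier GSp n g = similitude n g"
| "multiplier SL n g = 1"
| "multiplier Ort n g = 1"
| "multiplier Sp n g = 1"

definition mult_grp :: "'k::field monoid" where
  "mult_grp = \<lparr>carrier = UNIV - {0}, mult = (*), one = 1\<rparr>"

text \<open>Complex functions on a group are total functions on the ambient type vanishing off the
  carrier, so that equality of functions on the group is HOL equality and
  the induced space is a linear subspace for the pointwise operations.\<close>

definition fscale :: "complex \<Rightarrow> ('g \<Rightarrow> complex) \<Rightarrow> 'g \<Rightarrow> complex" where
  "fscale c f = (\<lambda>x. c * f x)"

definition Ind :: "'g monoid \<Rightarrow> 'g set \<Rightarrow> ('g \<Rightarrow> complex) \<Rightarrow> ('g \<Rightarrow> complex) set" where
  "Ind G P \<chi> = {f. (\<forall>x. x \<notin> carrier G \<longrightarrow> f x = 0) \<and>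
     (\<forall>p \<in> P. \<forall>g \<in> carrier G. f (p \<otimes>\<^bsub>G\<^esub> g) = \<chi> p * f g)}"

definition rtrans :: "'g monoid \<Rightarrow> 'g \<Rightarrow> ('g \<Rightarrow> complex) \<Rightarrow> 'g \<Rightarrow> complex" where
  "rtrans G g f = (\<lambda>x. if x \<in> carrier G then f (x \<otimes>\<^bsub>G\<^esub> g) else 0)"

text \<open>Likewise an endomorphism of a space \<open>V\<close> of functions is extended by \<open>0\<close> off \<open>V\<close>.
  Without this normalisation the dimension below would count values off \<open>V\<close>.\<close>

definition End_G :: "'g monoid \<Rightarrow> ('g \<Rightarrow> complex) set \<Rightarrow>
    (('g \<Rightarrow> complex) \<Rightarrow> 'g \<Rightarrow> complex) set" where
  "End_G G V = {T.
     (\<forall>f. f \<notin> V \<longrightarrow> T f = 0) \<and>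
     (\<forall>f \<in> V. T f \<in> V) \<and>
     (\<forall>f \<in> V. \<forall>h \<in> V. T (f + h) = T f + T h) \<and>
     (\<forall>c. \<forall>f \<in> V. T (fscale c f) = fscale c (T f)) \<and>
     (\<forall>g \<in> carrier G. \<forall>f \<in> V. T (rtrans G g f) = rtrans G g (T f))}"

definition opscale :: "complex \<Rightarrow> (('g \<Rightarrow> complex) \<Rightarrow> 'g \<Rightarrow> complex) \<Rightarrow>
    ('g \<Rightarrow> complex) \<Rightarrow> 'g \<Rightarrow> complex" where
  "opscale c T = (\<lambda>f. fscale c (T f))"

lemma vector_space_fscale: "vector_space (fscale :: complex \<Rightarrow> ('g \<Rightarrow> complex) \<Rightarrow> _)"
  by unfold_locales (auto simp: fscale_def fun_eq_iff algebra_simps)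

lemma vector_space_opscale:
  "vector_space (opscale :: complex \<Rightarrow> (('g \<Rightarrow> complex) \<Rightarrow> 'g \<Rightarrow> complex) \<Rightarrow> _)"
  by unfold_locales (auto simp: opscale_def fscale_def fun_eq_iff algebra_simps)

definition irreducible_rep :: "'g monoid \<Rightarrow> ('g \<Rightarrow> complex) set \<Rightarrow> bool" where
  "irreducible_rep G V \<longleftrightarrow> V \<noteq> {0} \<and>
     (\<forall>W. module.subspace fscale W \<and> W \<subseteq> V \<and>
          (\<forall>g \<in> carrier G. \<forall>f \<in> W. rtrans G g f \<in> W) \<longrightarrow> W = {0} \<or> W = V)"

end

theory Submission
  imports Defs
begin

text \<open>
  By Mackey's theory the endomorphisms of \<open>Ind G P \<chi>\<close> are the convolutions with functions \<open>\<phi>\<close> that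
  satisfy \<open>\<phi> (p g q) = \<chi> p \<phi> g \<chi> q\<close> for \<open>p\<close>, \<open>q\<close> in \<open>P\<close>: the representation is generated by one function
  supported on \<open>P\<close>, and an endomorphism is determined by the image of that function. Such a \<open>\<phi>\<close> is given
  by its values at representatives of the double cosets of \<open>P\<close>, and the value at \<open>w\<close> may be nonzero
  exactly if \<open>w\<close> is admissible, which means that \<open>\<chi> p = \<chi> q\<close> whenever \<open>p w = w q\<close>. So the dimension is
  the number of admissible double cosets (\<open>dim_End_Ind\<close>).

  For all six families the double cosets are indexed by the rank \<open>r\<close> of the lower left block, which
  takes all values from \<open>0\<close> to \<open>n\<close> (\<open>double_cosets_cover\<close>, \<open>double_cosets_disjoint\<close>). The representative
  of rank \<open>r\<close> exchanges, up to sign, the first \<open>r\<close> coordinates of the two halves of the space. Suppose that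
  \<open>p w = w q\<close>, and let \<open>a\<close> and \<open>d\<close> be the determinants of the diagonal blocks of size \<open>r\<close> in the blocks
  \<open>A\<close> and \<open>D\<close> of \<open>p\<close>. Passing from \<open>p\<close> to \<open>q\<close> keeps the multiplier and replaces the factor \<open>d\<close> of
  \<open>det D\<close> by \<open>a\<close>. So rank \<open>r\<close> is admissible if and only if \<open>\<beta> a = \<beta> d\<close> for all possible \<open>a\<close> and \<open>d\<close>.

  This holds for \<open>r = 0\<close>, and for all \<open>r\<close> if \<open>\<beta>\<close> is trivial. Let \<open>r \<ge> 1\<close> and \<open>\<beta>\<close> be nontrivial. The pair
  \<open>d = x\<close>, \<open>a = 1 / x\<close> occurs in every family and forces \<open>\<beta>\<^sup>2 = 1\<close>. In the general linear group \<open>a\<close> and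
  \<open>d\<close> are independent, so no such \<open>r\<close> is admissible. In the special linear group they are independent for
  \<open>r < n\<close>, while \<open>a d = 1\<close> for \<open>r = n\<close>. In the groups of a form \<open>a d = \<lambda> ^ r\<close> with the multiplier \<open>\<lambda>\<close>;
  if \<open>\<beta>\<^sup>2 = 1\<close>, this leaves the condition \<open>\<beta> \<lambda> ^ r = 1\<close>, which is void if \<open>\<lambda> = 1\<close> and means that \<open>r\<close> is even
  if \<open>\<lambda>\<close> is arbitrary. Counting the admissible \<open>r\<close> gives the formula (\<open>admissible_ranks\<close>).

  If \<open>\<beta>\<^sup>2 \<noteq> 1\<close>, only \<open>r = 0\<close> is left and all endomorphisms are homotheties; since invariant subspaces are
  images of endomorphisms, the representation is irreducible (\<open>irreducible_if_dim_End_1\<close>).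
\<close>

section \<open>Endomorphisms of an induced representation\<close>

text \<open>Coordinate functionals \<open>ev i\<close> dual to a family \<open>t\<close> recover the coefficients of a
  combination of \<open>t\<close>, so they give injectivity and independence of \<open>t\<close> at once.\<close>

lemma (in vector_space) dim_by_coordinates:
  assumes "finite A"
    and t: "\<And>i. i \<in> A \<Longrightarrow> t i \<in> V"
    and expand: "\<And>v. v \<in> V \<Longrightarrow> v = (\<Sum>i\<in>A. scale (ev i v) (t i))"
    and coord: "\<And>c j. j \<in> A \<Longrightarrow> ev j (\<Sum>i\<in>A. scale (c i) (t i)) = c j"
  shows "dim V = card A"
proof -
  have uniq: "c j = c' j" if "(\<Sum>i\<in>A. scale (c i) (t i)) = (\<Sum>i\<in>A. scale (c' i) (t i))" "j \<in> A"
    for c c' j using coord[OF that(2)] that(1) by metis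
  have unit_sum: "(\<Sum>i\<in>A. scale (if i = k then 1 else 0) (t i)) = t k" if "k \<in> A" for k
    using \<open>finite A\<close> that by (simp add: if_distrib[of "\<lambda>c. scale c _"] sum.delta cong: if_cong)
  have inj: "inj_on t A"
  proof
    fix i j assume "i \<in> A" "j \<in> A" "t i = t j"
    then have "(\<Sum>l\<in>A. scale (if l = i then 1 else 0) (t l)) = (\<Sum>l\<in>A. scale (if l = j then 1 else 0) (t l))"
      using unit_sum by simp
    from uniq[OF this \<open>i \<in> A\<close>] show "i = j" by (simp split: if_splits)
  qed
  have "independent (t ` A)"
  proof (rule independent_if_scalars_zero)
    fix f x assume z: "(\<Sum>x\<in>t ` A. scale (f x) x) = 0" and "x \<in> t ` A"
    then obtain j where j: "j \<in> A" "x = t j" by blast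
    have "(\<Sum>i\<in>A. scale (f (t i)) (t i)) = (\<Sum>i\<in>A. scale 0 (t i))"
      using z inj by (simp add: sum.reindex)
    from uniq[OF this j(1)] show "f x = 0" using j(2) by simp
  qed (use \<open>finite A\<close> in simp)
  moreover have "V \<subseteq> span (t ` A)"
  proof
    fix v assume "v \<in> V"
    have "(\<Sum>i\<in>A. scale (ev i v) (t i)) \<in> span (t ` A)"
      by (intro span_sum span_scale span_base) simp
    then show "v \<in> span (t ` A)" using expand[OF \<open>v \<in> V\<close>] by simp
  qed
  moreover have "t ` A \<subseteq> V" using t by blast
  ultimately show ?thesis using card_image[OF inj] dim_unique by metis
qed

interpretation fun_space: vector_space "fscale :: complex \<Rightarrow> ('x \<Rightarrow> complex) \<Rightarrow> _"
  by (rule vector_space_fscale)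

interpretation op_space: vector_space
  "opscale :: complex \<Rightarrow> (('x \<Rightarrow> complex) \<Rightarrow> 'x \<Rightarrow> complex) \<Rightarrow> _"
  by (rule vector_space_opscale)

lemma fun_sum_apply: "(\<Sum>i\<in>A. f i) x = (\<Sum>i\<in>A. f i x)"
  for f :: "'i \<Rightarrow> 'x \<Rightarrow> 'b::comm_monoid_add"
  by (induction A rule: infinite_finite_induct) auto

locale induced_character = group G for G :: "'g monoid" (structure) +
  fixes P :: "'g set" and \<chi> :: "'g \<Rightarrow> complex"
  assumes finite_carrier: "finite (carrier G)"
    and subgroup_P: "subgroup P G"
    and chi_mult: "\<And>p q. p \<in> P \<Longrightarrow> q \<in> P \<Longrightarrow> \<chi> (p \<otimes> q) = \<chi> p * \<chi> q"
    and chi_nonzero: "\<And>p. p \<in> P \<Longrightarrow> \<chi> p \<noteq> 0"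
begin

abbreviation V where "V \<equiv> Ind G P \<chi>"

text \<open>The function \<open>gen\<close> is \<open>\<chi>\<close> on \<open>P\<close>, extended by zero. The factor \<open>1 / card P\<close> makes it the unit
  for the convolution below.\<close>

definition gen :: "'g \<Rightarrow> complex" where
  "gen x = (if x \<in> P then \<chi> x / card P else 0)"

text \<open>These are the functions with \<open>\<phi> (p \<otimes> g \<otimes> q) = \<chi> p * \<phi> g * \<chi> q\<close>, the Hecke algebra of \<open>(G, P, \<chi>)\<close>.\<close>

definition hecke :: "('g \<Rightarrow> complex) set" where
  "hecke = {\<phi> \<in> V. \<forall>g \<in> carrier G. \<forall>p \<in> P. \<phi> (g \<otimes> p) = \<phi> g * \<chi> p}"

definition convolve :: "('g \<Rightarrow> complex) \<Rightarrow> ('g \<Rightarrow> complex) \<Rightarrow> 'g \<Rightarrow> complex" where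
  "convolve \<phi> f = (if f \<in> V
     then (\<lambda>x. if x \<in> carrier G then \<Sum>y\<in>carrier G. \<phi> (x \<otimes> inv y) * f y else 0)
     else 0)"

lemma P_carrier [simp]: "p \<in> P \<Longrightarrow> p \<in> carrier G"
  using subgroup.mem_carrier[OF subgroup_P] .

lemma P_closed [simp]: "p \<in> P \<Longrightarrow> q \<in> P \<Longrightarrow> p \<otimes> q \<in> P"
  using subgroup.m_closed[OF subgroup_P] .

lemma P_inv [simp]: "p \<in> P \<Longrightarrow> inv p \<in> P"
  using subgroup.m_inv_closed[OF subgroup_P] .

lemma P_one [simp]: "\<one> \<in> P"
  using subgroup.one_closed[OF subgroup_P] .

lemma inv_cancel [simp]:
  "g \<in> carrier G \<Longrightarrow> x \<in> carrier G \<Longrightarrow> g \<otimes> (inv g \<otimes> x) = x"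
  "g \<in> carrier G \<Longrightarrow> x \<in> carrier G \<Longrightarrow> inv g \<otimes> (g \<otimes> x) = x"
  by (simp_all add: m_assoc[symmetric])

lemma P_cancel: "p \<in> P \<Longrightarrow> g \<in> carrier G \<Longrightarrow> p \<otimes> g \<in> P \<longleftrightarrow> g \<in> P"
  using P_closed[of "inv p" "p \<otimes> g"] by (auto simp: m_assoc)

lemma P_cancel': "p \<in> P \<Longrightarrow> g \<in> carrier G \<Longrightarrow> g \<otimes> p \<in> P \<longleftrightarrow> g \<in> P"
  using P_closed[of "g \<otimes> p" "inv p"] by (auto simp: m_assoc)

lemma finite_P [simp]: "finite P"
  using finite_subset[OF subgroup.subset[OF subgroup_P] finite_carrier] .

lemma card_P [simp]: "card P \<noteq> 0"
  by (metis P_one card_0_eq empty_iff finite_P)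

lemma chi_one [simp]: "\<chi> \<one> = 1"
  using chi_mult[of \<one> \<one>] chi_nonzero[of \<one>] by simp

lemma chi_inv: "p \<in> P \<Longrightarrow> \<chi> (inv p) = inverse (\<chi> p)"
  using chi_mult[of p "inv p"] by (simp add: inverse_unique)

lemma IndD: "f \<in> V \<Longrightarrow> p \<in> P \<Longrightarrow> g \<in> carrier G \<Longrightarrow> f (p \<otimes> g) = \<chi> p * f g"
  by (simp add: Ind_def)

lemma Ind_off: "f \<in> V \<Longrightarrow> x \<notin> carrier G \<Longrightarrow> f x = 0"
  by (simp add: Ind_def)

lemma subspace_Ind: "fun_space.subspace V"
  by (auto simp: fun_space.subspace_def Ind_def fscale_def algebra_simps)

lemma rtrans_Ind: "f \<in> V \<Longrightarrow> g \<in> carrier G \<Longrightarrow> rtrans G g f \<in> V"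
  by (auto simp: Ind_def rtrans_def m_assoc)

lemma gen_Ind: "gen \<in> V"
  by (auto simp: Ind_def gen_def P_cancel chi_mult)

text \<open>Only the \<open>y\<close> in the coset of \<open>x\<close> contribute at \<open>x\<close>, and each of these \<open>card P\<close> terms equals
  \<open>f x / card P\<close>. Hence \<open>gen\<close> generates the induced representation.\<close>

lemma Ind_expand:
  assumes "f \<in> V"
  shows "f = (\<Sum>y\<in>carrier G. fscale (f y) (rtrans G (inv y) gen))"
proof
  fix x show "f x = (\<Sum>y\<in>carrier G. fscale (f y) (rtrans G (inv y) gen)) x"
  proof (cases "x \<in> carrier G")
    case False
    then show ?thesis using Ind_off[OF assms] by (simp add: fun_sum_apply fscale_def rtrans_def)
  next
    case x: True
    have "(\<Sum>y\<in>carrier G. fscale (f y) (rtrans G (inv y) gen)) x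
        = (\<Sum>y\<in>carrier G. f y * gen (x \<otimes> inv y))"
      using x by (simp add: fun_sum_apply fscale_def rtrans_def)
    also have "\<dots> = (\<Sum>y\<in>{y \<in> carrier G. x \<otimes> inv y \<in> P}. f y * gen (x \<otimes> inv y))"
      using finite_carrier by (intro sum.mono_neutral_right) (auto simp: gen_def)
    also have "\<dots> = (\<Sum>p\<in>P. f x / card P)"
    proof (rule sum.reindex_bij_witness[of _ "\<lambda>p. inv p \<otimes> x" "\<lambda>y. x \<otimes> inv y"])
      fix y assume y: "y \<in> {y \<in> carrier G. x \<otimes> inv y \<in> P}"
      then show "inv (x \<otimes> inv y) \<otimes> x = y" "x \<otimes> inv y \<in> P"
        using x by (auto simp: inv_mult_group m_assoc)
      have "f x = f ((x \<otimes> inv y) \<otimes> y)" using x y by (simp add: m_assoc)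
      also have "\<dots> = \<chi> (x \<otimes> inv y) * f y" using y IndD[OF assms] by blast
      finally show "f x / card P = f y * gen (x \<otimes> inv y)" using y by (simp add: gen_def)
    next
      fix p assume "p \<in> P"
      then show "x \<otimes> inv (inv p \<otimes> x) = p" "inv p \<otimes> x \<in> {y \<in> carrier G. x \<otimes> inv y \<in> P}"
        using x by (auto simp: inv_mult_group m_assoc)
    qed
    also have "\<dots> = f x" by simp
    finally show ?thesis by simp
  qed
qed

lemma
  assumes "T \<in> End_G G V" and "f \<in> V"
  shows End_scale: "T (fscale c f) = fscale c (T f)"
    and End_add: "h \<in> V \<Longrightarrow> T (f + h) = T f + T h"
    and End_rtrans: "g \<in> carrier G \<Longrightarrow> T (rtrans G g f) = rtrans G g (T f)"
  using assms unfolding End_G_def by blast+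

lemma End_sum:
  assumes T: "T \<in> End_G G V" and "finite A" and h: "\<And>i. i \<in> A \<Longrightarrow> h i \<in> V"
  shows "T (\<Sum>i\<in>A. fscale (c i) (h i)) = (\<Sum>i\<in>A. fscale (c i) (T (h i)))"
  using assms(2) h
proof (induction A rule: finite_induct)
  case empty
  have "T (fscale 0 gen) = fscale 0 (T gen)" using End_scale[OF T gen_Ind] .
  then show ?case by (simp only: sum.empty fun_space.scale_zero_left)
next
  case (insert i A)
  have "fscale (c i) (h i) \<in> V" "(\<Sum>j\<in>A. fscale (c j) (h j)) \<in> V"
    using insert.prems subspace_Ind
    by (auto intro!: fun_space.subspace_sum fun_space.subspace_scale)
  then show ?case
    using insert by (simp only: sum.insert[OF insert.hyps] End_add[OF T] End_scale[OF T] insertI1 insertI2)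
qed

text \<open>An endomorphism is determined by its value at the generator, through a convolution.\<close>

lemma End_expand:
  assumes T: "T \<in> End_G G V" and "f \<in> V" and "x \<in> carrier G"
  shows "T f x = (\<Sum>y\<in>carrier G. T gen (x \<otimes> inv y) * f y)"
proof -
  have "T f = T (\<Sum>y\<in>carrier G. fscale (f y) (rtrans G (inv y) gen))"
    using Ind_expand[OF assms(2)] by simp
  also have "\<dots> = (\<Sum>y\<in>carrier G. fscale (f y) (T (rtrans G (inv y) gen)))"
    by (intro End_sum[OF T finite_carrier] rtrans_Ind gen_Ind) simp
  also have "\<dots> = (\<Sum>y\<in>carrier G. fscale (f y) (rtrans G (inv y) (T gen)))"
    using T gen_Ind by (intro sum.cong) (auto simp: End_G_def)
  finally show ?thesis using assms(3) by (simp add: fun_sum_apply fscale_def rtrans_def mult.commute)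
qed

text \<open>Right translation by \<open>p\<close> multiplies \<open>gen\<close> by \<open>\<chi> p\<close>, hence does the same to its image.\<close>

lemma End_gen_hecke:
  assumes T: "T \<in> End_G G V"
  shows "T gen \<in> hecke"
proof -
  have "T gen (g \<otimes> p) = T gen g * \<chi> p" if "g \<in> carrier G" "p \<in> P" for g p
  proof -
    have "rtrans G p gen = fscale (\<chi> p) gen"
      using that by (auto simp: rtrans_def fscale_def gen_def P_cancel' chi_mult fun_eq_iff)
    then have "rtrans G p (T gen) = fscale (\<chi> p) (T gen)"
      using End_scale[OF T gen_Ind] End_rtrans[OF T gen_Ind] that by (metis P_carrier)
    then show ?thesis using that by (auto simp: rtrans_def fscale_def fun_eq_iff split: if_splits)
  qed
  moreover have "T gen \<in> V" using T gen_Ind by (simp add: End_G_def)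
  ultimately show ?thesis by (simp add: hecke_def)
qed

lemma convolve_End:
  assumes "\<phi> \<in> V"
  shows "convolve \<phi> \<in> End_G G V"
proof -
  have "convolve \<phi> f \<in> V" if "f \<in> V" for f
    using that assms
    by (auto simp: convolve_def Ind_def m_assoc sum_distrib_left mult.assoc)
  moreover have "convolve \<phi> (f + h) = convolve \<phi> f + convolve \<phi> h" if "f \<in> V" "h \<in> V" for f h
    using that fun_space.subspace_add[OF subspace_Ind that]
    by (auto simp: convolve_def fun_eq_iff algebra_simps sum.distrib)
  moreover have "convolve \<phi> (fscale c f) = fscale c (convolve \<phi> f)" if "f \<in> V" for f c
    using that fun_space.subspace_scale[OF subspace_Ind that]
    by (auto simp: convolve_def fun_eq_iff fscale_def algebra_simps sum_distrib_left)
  moreover have "convolve \<phi> (rtrans G g f) = rtrans G g (convolve \<phi> f)"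
    if g: "g \<in> carrier G" and f: "f \<in> V" for f g
  proof
    fix x
    have "(\<Sum>y\<in>carrier G. \<phi> (x \<otimes> inv y) * f (y \<otimes> g))
        = (\<Sum>y\<in>carrier G. \<phi> (x \<otimes> g \<otimes> inv y) * f y)" if "x \<in> carrier G"
      by (rule sum.reindex_bij_witness[of _ "\<lambda>y. y \<otimes> inv g" "\<lambda>y. y \<otimes> g"])
        (use g that in \<open>auto simp: inv_mult_group m_assoc\<close>)
    then show "convolve \<phi> (rtrans G g f) x = rtrans G g (convolve \<phi> f) x"
      using f g rtrans_Ind[OF f g] by (simp add: convolve_def rtrans_def)
  qed
  ultimately show ?thesis by (auto simp: End_G_def convolve_def)
qed

lemma convolve_gen:
  assumes "\<phi> \<in> hecke"
  shows "convolve \<phi> gen = \<phi>"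
proof
  fix x show "convolve \<phi> gen x = \<phi> x"
  proof (cases "x \<in> carrier G")
    case x: True
    have "convolve \<phi> gen x = (\<Sum>y\<in>carrier G. \<phi> (x \<otimes> inv y) * gen y)"
      using x gen_Ind by (simp add: convolve_def)
    also have "\<dots> = (\<Sum>y\<in>P. \<phi> (x \<otimes> inv y) * gen y)"
      using finite_carrier by (intro sum.mono_neutral_right) (auto simp: gen_def)
    also have "\<dots> = (\<Sum>y\<in>P. \<phi> x / card P)"
      using assms x chi_nonzero by (intro sum.cong) (auto simp: hecke_def gen_def chi_inv)
    also have "\<dots> = \<phi> x" by simp
    finally show ?thesis .
  next
    case False
    have "\<phi> \<in> V" using assms by (simp add: hecke_def)
    then show ?thesis using False gen_Ind Ind_off[of \<phi>] by (simp add: convolve_def)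
  qed
qed

lemma End_eq_convolve:
  assumes "T \<in> End_G G V"
  shows "T = convolve (T gen)"
proof -
  have "T f = 0" if "f \<notin> V" for f using assms that by (simp add: End_G_def)
  moreover have "T f x = 0" if "f \<in> V" "x \<notin> carrier G" for f x
    using assms that by (auto simp: End_G_def intro: Ind_off)
  ultimately show ?thesis
    using End_expand[OF assms] by (auto simp: fun_eq_iff convolve_def)
qed

text \<open>Evaluated at an element \<open>p \<otimes> w = w \<otimes> q\<close>, a Hecke function satisfies
  \<open>\<chi> p * \<phi> w = \<phi> w * \<chi> q\<close>. So it can be nonzero at \<open>w\<close> only under the following condition, which is
  Mackey's: \<open>\<chi>\<close> and its conjugate by \<open>w\<close> agree where both are defined.\<close>

definition admissible :: "'g \<Rightarrow> bool" where
  "admissible w \<longleftrightarrow> (\<forall>p\<in>P. \<forall>q\<in>P. p \<otimes> w = w \<otimes> q \<longrightarrow> \<chi> p = \<chi> q)"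

text \<open>For an admissible \<open>w\<close> this is the Hecke function supported on the double coset of \<open>w\<close> with value
  \<open>1\<close> at \<open>w\<close>; by \<open>coset_fun_value\<close> the value does not depend on the factorization that is chosen.\<close>

definition coset_fun :: "'g \<Rightarrow> 'g \<Rightarrow> complex" where
  "coset_fun w x = (if \<exists>p\<in>P. \<exists>q\<in>P. x = p \<otimes> w \<otimes> q
     then SOME c. \<exists>p\<in>P. \<exists>q\<in>P. x = p \<otimes> w \<otimes> q \<and> c = \<chi> p * \<chi> q else 0)"

text \<open>Two factorizations of the same element differ by a pair \<open>(p, q)\<close> with \<open>p \<otimes> w = w \<otimes> q\<close>, so
  admissibility makes the value well defined.\<close>

lemma coset_fun_value:
  assumes w: "w \<in> carrier G" "admissible w" and pq: "p \<in> P" "q \<in> P"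
  shows "coset_fun w (p \<otimes> w \<otimes> q) = \<chi> p * \<chi> q"
proof -
  have wd: "\<chi> p * \<chi> q = \<chi> p' * \<chi> q'" if "p' \<in> P" "q' \<in> P" "p \<otimes> w \<otimes> q = p' \<otimes> w \<otimes> q'" for p' q'
  proof -
    have "(inv p' \<otimes> p) \<otimes> w = inv p' \<otimes> (p \<otimes> w \<otimes> q) \<otimes> inv q"
      using w pq that(1,2) by (simp add: m_assoc)
    also have "\<dots> = w \<otimes> (q' \<otimes> inv q)"
      unfolding that(3) using w pq that(1,2) by (simp add: m_assoc)
    finally have eq: "(inv p' \<otimes> p) \<otimes> w = w \<otimes> (q' \<otimes> inv q)" .
    have "inv p' \<otimes> p \<in> P" "q' \<otimes> inv q \<in> P" using pq that(1,2) by simp_all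
    then have "\<chi> (inv p' \<otimes> p) = \<chi> (q' \<otimes> inv q)"
      using eq w(2) unfolding admissible_def by blast
    then have "inverse (\<chi> p') * \<chi> p = \<chi> q' * inverse (\<chi> q)"
      using pq that(1,2) by (simp add: chi_mult chi_inv)
    then show ?thesis
      using chi_nonzero[OF that(1)] chi_nonzero[OF pq(2)] by (simp add: field_simps)
  qed
  have "(SOME c. \<exists>p'\<in>P. \<exists>q'\<in>P. p \<otimes> w \<otimes> q = p' \<otimes> w \<otimes> q' \<and> c = \<chi> p' * \<chi> q') = \<chi> p * \<chi> q"
  proof (rule some_equality)
    show "\<exists>p'\<in>P. \<exists>q'\<in>P. p \<otimes> w \<otimes> q = p' \<otimes> w \<otimes> q' \<and> \<chi> p * \<chi> q = \<chi> p' * \<chi> q'"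
      using pq by blast
    show "c = \<chi> p * \<chi> q" if "\<exists>p'\<in>P. \<exists>q'\<in>P. p \<otimes> w \<otimes> q = p' \<otimes> w \<otimes> q' \<and> c = \<chi> p' * \<chi> q'" for c
      using that wd by metis
  qed
  moreover have "\<exists>p'\<in>P. \<exists>q'\<in>P. p \<otimes> w \<otimes> q = p' \<otimes> w \<otimes> q'" using pq by blast
  ultimately show ?thesis by (simp only: coset_fun_def if_True)
qed

definition double_coset :: "'g \<Rightarrow> 'g set" where
  "double_coset w = {x. \<exists>p\<in>P. \<exists>q\<in>P. x = p \<otimes> w \<otimes> q}"

lemma double_cosetI: "p \<in> P \<Longrightarrow> q \<in> P \<Longrightarrow> p \<otimes> w \<otimes> q \<in> double_coset w"
  by (auto simp: double_coset_def)

lemma double_cosetE: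
  assumes "x \<in> double_coset w"
  obtains p q where "p \<in> P" "q \<in> P" "x = p \<otimes> w \<otimes> q"
  using assms by (auto simp: double_coset_def)

lemma double_coset_mult:
  assumes w: "w \<in> carrier G" and "x \<in> double_coset w" and p: "p \<in> P"
  shows "p \<otimes> x \<in> double_coset w" and "x \<otimes> p \<in> double_coset w"
proof -
  obtain p' q' where x: "p' \<in> P" "q' \<in> P" "x = p' \<otimes> w \<otimes> q'"
    using assms(2) by (rule double_cosetE)
  have "p \<otimes> x = (p \<otimes> p') \<otimes> w \<otimes> q'" "x \<otimes> p = p' \<otimes> w \<otimes> (q' \<otimes> p)"
    using x w p by (simp_all add: m_assoc)
  moreover have "p \<otimes> p' \<in> P" "q' \<otimes> p \<in> P" using x p by simp_all
  ultimately show "p \<otimes> x \<in> double_coset w" "x \<otimes> p \<in> double_coset w"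
    using x by (simp_all only: double_cosetI)
qed

lemma double_coset_mult_iff:
  assumes w: "w \<in> carrier G" and g: "g \<in> carrier G" and p: "p \<in> P"
  shows "p \<otimes> g \<in> double_coset w \<longleftrightarrow> g \<in> double_coset w"
    and "g \<otimes> p \<in> double_coset w \<longleftrightarrow> g \<in> double_coset w"
proof -
  have "inv p \<otimes> (p \<otimes> g) = g" "g \<otimes> p \<otimes> inv p = g" using g p by (simp_all add: m_assoc)
  then show "p \<otimes> g \<in> double_coset w \<longleftrightarrow> g \<in> double_coset w"
    and "g \<otimes> p \<in> double_coset w \<longleftrightarrow> g \<in> double_coset w"
    using double_coset_mult[OF w _ p] double_coset_mult[OF w _ P_inv[OF p]] by metis+
qed

lemma coset_fun_hecke:
  assumes w: "w \<in> carrier G" "admissible w"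
  shows "coset_fun w \<in> hecke"
proof -
  have off: "coset_fun w x = 0" if "x \<notin> double_coset w" for x
    using that by (auto simp: coset_fun_def double_coset_def)
  have left: "coset_fun w (p \<otimes> g) = \<chi> p * coset_fun w g" if g: "g \<in> carrier G" and p: "p \<in> P" for p g
  proof (cases "g \<in> double_coset w")
    case True
    then obtain p' q' where *: "p' \<in> P" "q' \<in> P" "g = p' \<otimes> w \<otimes> q'" by (rule double_cosetE)
    have "p \<otimes> g = (p \<otimes> p') \<otimes> w \<otimes> q'" using w p * by (simp add: m_assoc)
    then show ?thesis
      using coset_fun_value[OF w P_closed[OF p *(1)] *(2)] coset_fun_value[OF w *(1,2)] *(3)
        chi_mult[OF p *(1)] by simp
  next
    case False
    then show ?thesis using double_coset_mult_iff[OF w(1) g p] by (simp add: off)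
  qed
  have right: "coset_fun w (g \<otimes> p) = coset_fun w g * \<chi> p" if g: "g \<in> carrier G" and p: "p \<in> P" for p g
  proof (cases "g \<in> double_coset w")
    case True
    then obtain p' q' where *: "p' \<in> P" "q' \<in> P" "g = p' \<otimes> w \<otimes> q'" by (rule double_cosetE)
    have "g \<otimes> p = p' \<otimes> w \<otimes> (q' \<otimes> p)" using w p * by (simp add: m_assoc)
    then show ?thesis
      using coset_fun_value[OF w *(1) P_closed[OF *(2) p]] coset_fun_value[OF w *(1,2)] *(3)
        chi_mult[OF *(2) p] by simp
  next
    case False
    then show ?thesis using double_coset_mult_iff[OF w(1) g p] by (simp add: off)
  qed
  have "double_coset w \<subseteq> carrier G" using w(1) by (auto simp: double_coset_def)
  then have "coset_fun w x = 0" if "x \<notin> carrier G" for x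
    using that off by blast
  with left right show ?thesis unfolding hecke_def Ind_def by blast
qed

lemma
  assumes "\<phi> \<in> hecke" and "g \<in> carrier G" and "p \<in> P"
  shows hecke_left: "\<phi> (p \<otimes> g) = \<chi> p * \<phi> g"
    and hecke_right: "\<phi> (g \<otimes> p) = \<phi> g * \<chi> p"
  using assms unfolding hecke_def Ind_def by blast+

lemma hecke_value:
  assumes "\<phi> \<in> hecke" "w \<in> carrier G" "p \<in> P" "q \<in> P"
  shows "\<phi> (p \<otimes> w \<otimes> q) = \<chi> p * \<phi> w * \<chi> q"
  using assms hecke_right[OF assms(1) _ assms(4), of "p \<otimes> w"] hecke_left[OF assms(1,2,3)] by simp

lemma hecke_zero_if_not_admissible:
  assumes "\<phi> \<in> hecke" "w \<in> carrier G" "\<not> admissible w"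
  shows "\<phi> w = 0"
proof -
  from assms(3) obtain p q where pq: "p \<in> P" "q \<in> P" "p \<otimes> w = w \<otimes> q" "\<chi> p \<noteq> \<chi> q"
    unfolding admissible_def by blast
  have "\<chi> p * \<phi> w = \<phi> w * \<chi> q"
    by (metis hecke_left[OF assms(1,2) pq(1)] hecke_right[OF assms(1,2) pq(2)] pq(3))
  then have "(\<chi> p - \<chi> q) * \<phi> w = 0" by (simp add: algebra_simps)
  then show ?thesis using pq(4) by simp
qed

text \<open>Endomorphisms correspond to Hecke functions, and a Hecke function is determined by its values at
  double coset representatives. These values are free at admissible representatives and zero at the
  others, so the functions \<open>coset_fun\<close> of admissible representatives give a basis.\<close>

theorem dim_End_Ind:
  fixes w :: "'i \<Rightarrow> 'g"
  assumes "finite I" and w: "\<And>i. i \<in> I \<Longrightarrow> w i \<in> carrier G"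
    and cover: "\<And>g. g \<in> carrier G \<Longrightarrow> \<exists>i\<in>I. \<exists>p\<in>P. \<exists>q\<in>P. g = p \<otimes> w i \<otimes> q"
    and disjoint: "\<And>i j p q. i \<in> I \<Longrightarrow> j \<in> I \<Longrightarrow> p \<in> P \<Longrightarrow> q \<in> P \<Longrightarrow> w j = p \<otimes> w i \<otimes> q \<Longrightarrow> i = j"
  shows "op_space.dim (End_G G V) = card {i \<in> I. admissible (w i)}"
proof (rule op_space.dim_by_coordinates[where t = "\<lambda>i. convolve (coset_fun (w i))" and ev = "\<lambda>i T. T gen (w i)"])
  let ?A = "{i \<in> I. admissible (w i)}"
  show "finite ?A" using \<open>finite I\<close> by simp
  show "convolve (coset_fun (w i)) \<in> End_G G V" if "i \<in> ?A" for i
    using that coset_fun_hecke w by (intro convolve_End) (auto simp: hecke_def)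
  have at: "coset_fun (w i) (w j) = (if i = j then 1 else 0)" if "i \<in> ?A" "j \<in> I" for i j
  proof (cases "i = j")
    case True
    then show ?thesis using coset_fun_value[of "w i" \<one> \<one>] w[of i] that by simp
  next
    case False
    then have "\<not> (\<exists>p\<in>P. \<exists>q\<in>P. w j = p \<otimes> w i \<otimes> q)" using disjoint that by blast
    then show ?thesis using False by (simp only: coset_fun_def if_False)
  qed
  have conv: "convolve (coset_fun (w i)) gen = coset_fun (w i)" if "i \<in> ?A" for i
    using that by (intro convolve_gen coset_fun_hecke w) auto
  have comb: "(\<Sum>i\<in>?A. opscale (c i) (convolve (coset_fun (w i)))) gen
      = (\<Sum>i\<in>?A. fscale (c i) (coset_fun (w i)))" for c
    by (rule ext, unfold fun_sum_apply opscale_def, rule sum.cong) (simp_all only: conv)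
  have comb_at: "(\<Sum>i\<in>?A. fscale (c i) (coset_fun (w i))) (w j)
      = (if admissible (w j) then c j else 0)" if "j \<in> I" for c j
  proof -
    have "(\<Sum>i\<in>?A. fscale (c i) (coset_fun (w i))) (w j) = (\<Sum>i\<in>?A. if i = j then c i else 0)"
      unfolding fun_sum_apply fscale_def by (intro sum.cong) (auto simp: at[OF _ that])
    then show ?thesis using \<open>finite I\<close> that by (simp add: sum.delta)
  qed
  show "(\<Sum>i\<in>?A. opscale (c i) (convolve (coset_fun (w i)))) gen (w j) = c j" if "j \<in> ?A" for c j
    unfolding comb using comb_at[of j c] that by simp
  fix T assume T: "T \<in> End_G G V"
  let ?S = "\<Sum>i\<in>?A. opscale (T gen (w i)) (convolve (coset_fun (w i)))"
  let ?h = "\<Sum>i\<in>?A. fscale (T gen (w i)) (coset_fun (w i))"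
  have h: "?h \<in> hecke"
  proof -
    have "fun_space.subspace hecke"
      using fun_space.subspace_0[OF subspace_Ind] fun_space.subspace_add[OF subspace_Ind]
        fun_space.subspace_scale[OF subspace_Ind]
      by (auto simp: fun_space.subspace_def hecke_def fscale_def algebra_simps)
    then show ?thesis using coset_fun_hecke w
      by (intro fun_space.subspace_sum fun_space.subspace_scale) auto
  qed
  have Tg: "T gen \<in> hecke" using End_gen_hecke[OF T] .
  have "T gen x = ?h x" for x
  proof (cases "x \<in> carrier G")
    case True
    then obtain i p q where i: "i \<in> I" and pq: "p \<in> P" "q \<in> P" and x: "x = p \<otimes> w i \<otimes> q"
      using cover by blast
    have eq: "?h (w i) = T gen (w i)"
      unfolding comb_at[OF i] using hecke_zero_if_not_admissible[OF Tg w[OF i]] by simp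
    show ?thesis
      unfolding x hecke_value[OF Tg w[OF i] pq] hecke_value[OF h w[OF i] pq] eq ..
  next
    case False
    show ?thesis using Tg h Ind_off[OF _ False] unfolding hecke_def by (metis (no_types, lifting) mem_Collect_eq)
  qed
  then have Tgen: "T gen = ?h" ..
  have S: "convolve ?h f x = ?S f x" for f x
  proof (cases "f \<in> V \<and> x \<in> carrier G")
    case True
    have "(\<Sum>y\<in>carrier G. ?h (x \<otimes> inv y) * f y)
        = (\<Sum>y\<in>carrier G. \<Sum>i\<in>?A. T gen (w i) * (coset_fun (w i) (x \<otimes> inv y) * f y))"
      by (simp only: fun_sum_apply fscale_def sum_distrib_right mult.assoc)
    also have "\<dots> = (\<Sum>i\<in>?A. T gen (w i) * (\<Sum>y\<in>carrier G. coset_fun (w i) (x \<otimes> inv y) * f y))"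
      by (subst sum.swap) (simp only: sum_distrib_left)
    finally show ?thesis
      using True by (simp only: convolve_def fun_sum_apply opscale_def fscale_def if_True simp_thms)
  qed (auto simp: convolve_def fun_sum_apply opscale_def fscale_def)
  have "T = convolve (T gen)" by (rule End_eq_convolve[OF T])
  also have "\<dots> = convolve ?h" using Tgen by (rule arg_cong)
  also have "\<dots> = ?S" by (intro ext S)
  finally show "T = ?S" .
qed

text \<open>By Maschke's averaging argument an invariant subspace \<open>W\<close> is the range of an endomorphism that is
  the identity on \<open>W\<close>. If all endomorphisms are homotheties, this one is zero or the identity.\<close>

theorem irreducible_if_dim_End_1:
  assumes "op_space.dim (End_G G V) = 1"
  shows "irreducible_rep G V"
proof -
  define I where "I f = (if f \<in> V then f else 0)" for f
  have I: "I \<in> End_G G V"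
    using fun_space.subspace_add[OF subspace_Ind] fun_space.subspace_scale[OF subspace_Ind] rtrans_Ind
    by (auto simp: End_G_def I_def)
  have gen0: "gen \<noteq> 0"
    using chi_nonzero[of \<one>] by (auto simp: gen_def fun_eq_iff intro!: exI[of _ \<one>])
  obtain B where B: "B \<subseteq> End_G G V" "End_G G V \<subseteq> op_space.span B" "card B = 1"
    using op_space.basis_exists[of "End_G G V"] assms by metis
  obtain b where b: "B = {b}" using B(3) card_1_singletonE by metis
  have scalar: "\<exists>c. T = opscale c b" if "T \<in> End_G G V" for T
    using B(2) that unfolding b op_space.span_singleton by blast
  obtain c0 where c0: "I = opscale c0 b" using scalar[OF I] by blast
  \<comment> \<open>The identity is itself a multiple of the basis element \<open>b\<close>, so \<open>b\<close> can be eliminated.\<close>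
  have homothety: "\<exists>c. \<forall>f\<in>V. T f = fscale c f" if T: "T \<in> End_G G V" for T
  proof -
    obtain c where c: "T = opscale c b" using scalar[OF T] by blast
    have "c0 \<noteq> 0"
    proof
      assume "c0 = 0"
      then have "I gen = 0" using c0 by (simp add: opscale_def)
      then show False using gen0 gen_Ind by (simp add: I_def)
    qed
    have "T f = fscale (c / c0) f" if "f \<in> V" for f
    proof -
      have "f = fscale c0 (b f)" using that c0 by (metis I_def opscale_def)
      then have "fscale (c / c0) f = fscale (c / c0) (fscale c0 (b f))" by simp
      also have "\<dots> = T f" using \<open>c0 \<noteq> 0\<close> by (simp add: c opscale_def)
      finally show ?thesis by simp
    qed
    then show ?thesis by blast
  qed
  have "W = {0} \<or> W = V"
    if W: "fun_space.subspace W" "W \<subseteq> V" and inv: "\<And>g f. g \<in> carrier G \<Longrightarrow> f \<in> W \<Longrightarrow> rtrans G g f \<in> W" for W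
  proof (cases "W = {0}")
    case False
    interpret pair: vector_space_pair "fscale :: complex \<Rightarrow> ('g \<Rightarrow> complex) \<Rightarrow> _"
      "fscale :: complex \<Rightarrow> ('g \<Rightarrow> complex) \<Rightarrow> _" ..
    have "\<exists>\<pi>. range \<pi> \<subseteq> W \<and> Vector_Spaces.linear fscale fscale \<pi> \<and> (\<forall>v\<in>W. \<pi> v = v)"
      using pair.linear_exists_left_inverse_on[of "\<lambda>x. x" W] W(1) fun_space.linear_ident by simp
    then obtain \<pi> where \<pi>: "range \<pi> \<subseteq> W" "Vector_Spaces.linear fscale fscale \<pi>" "\<And>v. v \<in> W \<Longrightarrow> \<pi> v = v"
      by blast
    interpret \<pi>: Vector_Spaces.linear fscale fscale \<pi> by (rule \<pi>(2))
    \<comment> \<open>The average of the conjugates of a linear projection onto \<open>W\<close> commutes with \<open>G\<close>.\<close>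
    define T where "T f = (if f \<in> V then fscale (1 / card (carrier G))
        (\<Sum>g\<in>carrier G. rtrans G (inv g) (\<pi> (rtrans G g f))) else 0)" for f
    have \<pi>W: "\<pi> f \<in> W" for f using \<pi>(1) by blast
    have TW: "T f \<in> W" for f
      unfolding T_def using W(1) inv \<pi>W
      by (auto intro!: fun_space.subspace_scale fun_space.subspace_sum fun_space.subspace_0)
    have rt_add: "rtrans G g (f + h) = rtrans G g f + rtrans G g h" for g f h
      by (auto simp: rtrans_def)
    have rt_scale: "rtrans G g (fscale c f) = fscale c (rtrans G g f)" for g c f
      by (auto simp: rtrans_def fscale_def)
    have rt_sum: "rtrans G g (\<Sum>i\<in>A. f i) = (\<Sum>i\<in>A. rtrans G g (f i))" for g f and A :: "'g set"
      by (auto simp: rtrans_def fun_sum_apply fun_eq_iff)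
    have rt_rt: "rtrans G g (rtrans G h f) = rtrans G (g \<otimes> h) f" if "g \<in> carrier G" "h \<in> carrier G" for g h f
      using that by (auto simp: rtrans_def m_assoc)
    have rt_one: "rtrans G \<one> f = f" if "f \<in> V" for f
      using Ind_off[OF that] that by (auto simp: rtrans_def fun_eq_iff)
    have "T \<in> End_G G V"
      unfolding End_G_def
    proof (intro CollectI conjI allI ballI impI)
      show "T f = 0" if "f \<notin> V" for f using that by (simp add: T_def)
      show "T f \<in> V" for f using TW W(2) by blast
      show "T (f + h) = T f + T h" if "f \<in> V" "h \<in> V" for f h
        using that fun_space.subspace_add[OF subspace_Ind that]
        by (simp add: T_def rt_add \<pi>.add sum.distrib fun_space.scale_right_distrib)
      show "T (fscale c f) = fscale c (T f)" if "f \<in> V" for f c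
        using that fun_space.subspace_scale[OF subspace_Ind that]
        by (simp add: T_def rt_scale \<pi>.scale fun_space.scale_sum_right mult.commute)
      fix g f assume g: "g \<in> carrier G" and f: "f \<in> V"
      have "(\<Sum>h\<in>carrier G. rtrans G (inv h) (\<pi> (rtrans G h (rtrans G g f))))
          = (\<Sum>h\<in>carrier G. rtrans G g (rtrans G (inv h) (\<pi> (rtrans G h f))))"
        by (rule sum.reindex_bij_witness[of _ "\<lambda>h. h \<otimes> inv g" "\<lambda>h. h \<otimes> g"])
          (use g in \<open>auto simp: rt_rt inv_mult_group m_assoc\<close>)
      then show "T (rtrans G g f) = rtrans G g (T f)"
        using f rtrans_Ind[OF f g] by (simp add: T_def rt_scale rt_sum)
    qed
    then obtain c where c: "\<And>f. f \<in> V \<Longrightarrow> T f = fscale c f" using homothety by blast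
    have fixed: "T f = f" if "f \<in> W" for f
    proof -
      have fV: "f \<in> V" using that W(2) by blast
      have "rtrans G (inv g) (\<pi> (rtrans G g f)) = f" if "g \<in> carrier G" for g
        using \<pi>(3)[OF inv[OF that \<open>f \<in> W\<close>]] that rt_rt[of "inv g" g f] rt_one[OF fV] by simp
      then have "T f = fscale (1 / card (carrier G)) (\<Sum>g\<in>carrier G. f)"
        using fV by (simp add: T_def)
      also have "\<dots> = f"
        using finite_carrier one_closed
        by (auto simp: fscale_def fun_sum_apply fun_eq_iff card_eq_0_iff)
      finally show ?thesis .
    qed
    obtain f where f: "f \<in> W" "f \<noteq> 0" using False fun_space.subspace_0[OF W(1)] by blast
    have "fscale c f = fscale 1 f" using c[of f] fixed[of f] f(1) W(2) by auto
    then have "c = 1" using f(2) fun_space.scale_right_imp_eq by blast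
    have "V \<subseteq> W" using TW c \<open>c = 1\<close> by (metis fun_space.scale_one subsetI)
    then show ?thesis using W(2) by blast
  qed simp
  moreover have "V \<noteq> {0}" using gen_Ind gen0 by blast
  ultimately show ?thesis
    unfolding irreducible_rep_def by blast
qed

end

section \<open>Invertible matrices\<close>

lemma GL_set_iff: "g \<in> GL_set k \<longleftrightarrow> g \<in> carrier_mat k k \<and> det g \<noteq> 0"
proof
  assume "g \<in> GL_set k"
  then obtain B where g: "g \<in> carrier_mat k k" and B: "g * B = 1\<^sub>m k" "B * g = 1\<^sub>m (dim_row B)"
    by (auto simp: GL_set_def invertible_mat_def inverts_mat_def)
  have "dim_col B = k" using arg_cong[OF B(1), of dim_col] by simp
  moreover have "dim_row B = k" using arg_cong[OF B(2), of dim_col] g by simp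
  ultimately have "B \<in> carrier_mat k k" by auto
  then have "det g * det B = 1" using det_mult[OF g] B(1) by (metis det_one)
  then show "g \<in> carrier_mat k k \<and> det g \<noteq> 0" using g by auto
next
  assume g: "g \<in> carrier_mat k k \<and> det g \<noteq> 0"
  then have "g \<in> Units (ring_mat TYPE('a) k ())" by (auto intro: det_non_zero_imp_unit)
  then show "g \<in> GL_set k" using g
    by (auto simp: GL_set_def invertible_mat_def inverts_mat_def Units_def ring_mat_def)
qed

lemma nonzero_det_inverse:
  fixes A :: "'a::field mat"
  assumes "A \<in> carrier_mat n n" "det A \<noteq> 0"
  obtains A' where "A' \<in> carrier_mat n n" "A * A' = 1\<^sub>m n" "A' * A = 1\<^sub>m n"
proof -
  have "A \<in> Units (ring_mat TYPE('a) n ())" using assms by (auto intro: det_non_zero_imp_unit)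
  then show thesis using that by (auto simp: Units_def ring_mat_def)
qed

lemma inverse_nonzero_det:
  fixes A :: "'a::field mat"
  assumes "A \<in> carrier_mat n n" "B \<in> carrier_mat n n" "A * B = 1\<^sub>m n"
  shows "det A \<noteq> 0" and "det B \<noteq> 0" and "det A * det B = 1"
proof -
  show "det A * det B = 1" using det_mult[OF assms(1,2)] assms(3) by (metis det_one)
  then show "det A \<noteq> 0" "det B \<noteq> 0" by auto
qed

section \<open>Square blocks\<close>

text \<open>The ring laws for matrices hold under carrier conditions only. With the dimension \<open>n\<close> instantiated
  these conditions contain no unknowns, and the simplifier can discharge them.\<close>

lemma square_mat_simps:
  fixes A B C :: "'a::comm_ring_1 mat" and n :: nat
  defines "M \<equiv> carrier_mat n n :: 'a mat set"
  shows "A \<in> M \<Longrightarrow> B \<in> M \<Longrightarrow> A * B \<in> M"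
    and "A \<in> M \<Longrightarrow> B \<in> M \<Longrightarrow> A + B \<in> M"
    and "A \<in> M \<Longrightarrow> B \<in> M \<Longrightarrow> A - B \<in> M"
    and "A \<in> M \<Longrightarrow> B \<in> M \<Longrightarrow> C \<in> M \<Longrightarrow> A * B * C = A * (B * C)"
    and "A \<in> M \<Longrightarrow> B \<in> M \<Longrightarrow> C \<in> M \<Longrightarrow> (A + B) * C = A * C + B * C"
    and "A \<in> M \<Longrightarrow> B \<in> M \<Longrightarrow> C \<in> M \<Longrightarrow> C * (A + B) = C * A + C * B"
    and "A \<in> M \<Longrightarrow> B \<in> M \<Longrightarrow> C \<in> M \<Longrightarrow> (A - B) * C = A * C - B * C"
    and "A \<in> M \<Longrightarrow> B \<in> M \<Longrightarrow> C \<in> M \<Longrightarrow> C * (A - B) = C * A - C * B"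
    and "A \<in> M \<Longrightarrow> B \<in> M \<Longrightarrow> A * (k \<cdot>\<^sub>m B) = k \<cdot>\<^sub>m (A * B)"
    and "A \<in> M \<Longrightarrow> B \<in> M \<Longrightarrow> (k \<cdot>\<^sub>m A) * B = k \<cdot>\<^sub>m (A * B)"
    and "A \<in> M \<Longrightarrow> B \<in> M \<Longrightarrow> (A * B)\<^sup>T = B\<^sup>T * A\<^sup>T"
    and "A \<in> M \<Longrightarrow> B \<in> M \<Longrightarrow> (A + B)\<^sup>T = A\<^sup>T + B\<^sup>T"
    and "A \<in> M \<Longrightarrow> B \<in> M \<Longrightarrow> (A - B)\<^sup>T = A\<^sup>T - B\<^sup>T"
    and "A \<in> M \<Longrightarrow> B \<in> M \<Longrightarrow> C \<in> M \<Longrightarrow> A + B + C = A + (B + C)"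
    and "A \<in> M \<Longrightarrow> A + 0\<^sub>m n n = A" and "A \<in> M \<Longrightarrow> 0\<^sub>m n n + A = A"
    and "A \<in> M \<Longrightarrow> A * 0\<^sub>m n n = 0\<^sub>m n n" and "A \<in> M \<Longrightarrow> 0\<^sub>m n n * A = 0\<^sub>m n n"
    and "A \<in> M \<Longrightarrow> 1\<^sub>m n * A = A" and "A \<in> M \<Longrightarrow> A * 1\<^sub>m n = A"
    and "A \<in> M \<Longrightarrow> - A \<in> M" and "A \<in> M \<Longrightarrow> k \<cdot>\<^sub>m A \<in> M" and "A \<in> M \<Longrightarrow> A\<^sup>T \<in> M"
  by (auto simp: M_def add_mult_distrib_mat[of _ n n] mult_add_distrib_mat[of _ n n] minus_mult_distrib_mat[of _ n n]
      mult_minus_distrib_mat[of _ n n] mult_smult_distrib[of _ n n] mult_smult_assoc_mat[of _ n n]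
      transpose_mult[of _ n n] transpose_add[of _ n n] transpose_minus[of _ n n])

lemma transpose_smult: "(k \<cdot>\<^sub>m A)\<^sup>T = k \<cdot>\<^sub>m A\<^sup>T"
  by (rule eq_matI) auto

lemma smult_smult_mat: "k \<cdot>\<^sub>m (l \<cdot>\<^sub>m A) = (k * l :: 'a::semigroup_mult) \<cdot>\<^sub>m A"
  by (rule eq_matI) (auto simp: mult.assoc)

lemma smult_one_mat [simp]: "(1 :: 'a::monoid_mult) \<cdot>\<^sub>m A = A"
  by (rule eq_matI) auto

lemma smult_zero_mat [simp]: "k \<cdot>\<^sub>m 0\<^sub>m n m = (0\<^sub>m n m :: 'a::mult_zero mat)"
  by (rule eq_matI) auto

lemma blk_eq_iff:
  assumes "A \<in> carrier_mat n n" "B \<in> carrier_mat n n" "C \<in> carrier_mat n n" "D \<in> carrier_mat n n"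
    and "A' \<in> carrier_mat n n" "B' \<in> carrier_mat n n" "C' \<in> carrier_mat n n" "D' \<in> carrier_mat n n"
  shows "four_block_mat A B C D = four_block_mat A' B' C' D' \<longleftrightarrow> A = A' \<and> B = B' \<and> C = C' \<and> D = D'"
proof
  assume eq: "four_block_mat A B C D = four_block_mat A' B' C' D'"
  have entries: "four_block_mat A B C D $$ (i, j) = four_block_mat A' B' C' D' $$ (i, j)" for i j
    by (simp add: eq)
  show "A = A' \<and> B = B' \<and> C = C' \<and> D = D'"
  proof (intro conjI; rule eq_matI)
    fix i j assume "i < dim_row A'" "j < dim_col A'"
    then show "A $$ (i, j) = A' $$ (i, j)" using entries[of i j] assms by auto
  next
    fix i j assume "i < dim_row B'" "j < dim_col B'"
    then show "B $$ (i, j) = B' $$ (i, j)" using entries[of i "j + n"] assms by auto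
  next
    fix i j assume "i < dim_row C'" "j < dim_col C'"
    then show "C $$ (i, j) = C' $$ (i, j)" using entries[of "i + n" j] assms by auto
  next
    fix i j assume "i < dim_row D'" "j < dim_col D'"
    then show "D $$ (i, j) = D' $$ (i, j)" using entries[of "i + n" "j + n"] assms by auto
  qed (use assms in auto)
qed simp

lemma split_block_blk:
  assumes "A \<in> carrier_mat n n" "B \<in> carrier_mat n n" "C \<in> carrier_mat n n" "D \<in> carrier_mat n n"
  shows "split_block (four_block_mat A B C D) n n = (A, B, C, D)"
proof -
  obtain A' B' C' D' where s: "split_block (four_block_mat A B C D) n n = (A', B', C', D')"
    using prod_cases4 by blast
  have dims: "dim_row (four_block_mat A B C D) = n + n" "dim_col (four_block_mat A B C D) = n + n"
    using assms by auto
  show ?thesis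
    using split_block[OF s dims] blk_eq_iff[OF assms, of A' B' C' D'] s by simp
qed

lemma four_blocksE:
  assumes "g \<in> carrier_mat (2 * n) (2 * n)"
  obtains A B C D where "A \<in> carrier_mat n n" "B \<in> carrier_mat n n" "C \<in> carrier_mat n n"
    "D \<in> carrier_mat n n" "g = four_block_mat A B C D"
proof -
  obtain A B C D where s: "split_block g n n = (A, B, C, D)" using prod_cases4 by blast
  show thesis using that split_block[OF s, of n n] assms by (auto simp: mult_2)
qed

lemma blk_carrier: "A \<in> carrier_mat n n \<Longrightarrow> D \<in> carrier_mat n n \<Longrightarrow>
    four_block_mat A B C D \<in> carrier_mat (2 * n) (2 * n)"
  by (simp add: mult_2)

section \<open>Coordinate projections and the rank normal form\<close>

text \<open>The projections to the first \<open>r\<close> and to the last \<open>n - r\<close> coordinates. Sandwiching a matrix between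
  them selects its blocks for the partition \<open>n = r + (n - r)\<close>, without a second layer of block
  matrices.\<close>

definition proj :: "nat \<Rightarrow> nat \<Rightarrow> 'a::field mat" where
  "proj n r = mat_diag n (\<lambda>i. if i < r then 1 else 0)"

definition coproj :: "nat \<Rightarrow> nat \<Rightarrow> 'a::field mat" where
  "coproj n r = mat_diag n (\<lambda>i. if i < r then 0 else 1)"

lemma mat_diag_cong: "(\<And>i. i < n \<Longrightarrow> f i = g i) \<Longrightarrow> mat_diag n f = mat_diag n g"
  by (rule eq_matI) (auto simp: mat_diag_def)

lemma mat_diag_add: "mat_diag n f + mat_diag n g = mat_diag n (\<lambda>i. f i + g i :: 'a::monoid_add)"
  by (rule eq_matI) (auto simp: mat_diag_def)

lemma mat_diag_smult: "k \<cdot>\<^sub>m mat_diag n f = mat_diag n (\<lambda>i. k * f i :: 'a::mult_zero)"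
  by (rule eq_matI) (auto simp: mat_diag_def)

lemma mat_diag_transpose [simp]: "(mat_diag n f)\<^sup>T = mat_diag n f"
  by (rule eq_matI) (auto simp: mat_diag_def)

lemma mat_diag_zero: "mat_diag n (\<lambda>i. 0) = 0\<^sub>m n n"
  by (rule eq_matI) (auto simp: mat_diag_def)

lemma det_mat_diag: "det (mat_diag n f) = (\<Prod>i<n. f i :: 'a::comm_ring_1)"
proof -
  have "det (mat_diag n f) = prod_list (diag_mat (mat_diag n f))"
    by (rule det_upper_triangular[of _ n]) (auto simp: mat_diag_def upper_triangular_def)
  also have "diag_mat (mat_diag n f) = map f [0..<n]"
    by (simp add: diag_mat_def mat_diag_def)
  also have "prod_list (map f [0..<n]) = (\<Prod>i<n. f i)"
    by (simp add: prod.distinct_set_conv_list[symmetric] lessThan_atLeast0)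
  finally show ?thesis .
qed

lemma proj_simps [simp]:
  "proj n r \<in> carrier_mat n n" "coproj n r \<in> carrier_mat n n"
  "proj n r * proj n r = proj n r" "coproj n r * coproj n r = coproj n r"
  "proj n r * coproj n r = 0\<^sub>m n n" "coproj n r * proj n r = 0\<^sub>m n n"
  "proj n r + coproj n r = 1\<^sub>m n" "coproj n r + proj n r = 1\<^sub>m n"
  "(proj n r)\<^sup>T = proj n r" "(coproj n r)\<^sup>T = coproj n r"
  unfolding proj_def coproj_def mat_diag_one[symmetric] mat_diag_zero[symmetric]
  by (auto simp: mat_diag_add simp del: mat_diag_one intro!: mat_diag_cong)

lemma proj_absorb [simp]:
  fixes A :: "'a::field mat"
  assumes "A \<in> carrier_mat n n"
  shows "proj n r * (proj n r * A) = proj n r * A" "coproj n r * (coproj n r * A) = coproj n r * A"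
    "proj n r * (coproj n r * A) = 0\<^sub>m n n" "coproj n r * (proj n r * A) = 0\<^sub>m n n"
proof -
  note assoc = square_mat_simps(4)[where n=n, OF _ _ assms, symmetric]
  show "proj n r * (proj n r * A) = proj n r * A" "coproj n r * (coproj n r * A) = coproj n r * A"
    "proj n r * (coproj n r * A) = 0\<^sub>m n n" "coproj n r * (proj n r * A) = 0\<^sub>m n n"
    using assms by (simp_all add: assoc del: assoc_mult_mat)
qed

text \<open>Multiplication does not increase the rank. If \<open>j < i\<close>, cut both factors down to
  maps between coordinate spaces of dimensions \<open>i\<close> and \<open>j\<close> and pad them with the identity on the last
  \<open>n - i\<close> coordinates. The padded factors multiply to the identity, but the left one has a zero
  column.\<close>

lemma rank_le_if_factor:
  fixes A B :: "'a::field mat"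
  assumes A: "A \<in> carrier_mat n n" and B: "B \<in> carrier_mat n n" and "i \<le> n"
    and eq: "proj n i = A * proj n j * B"
  shows "i \<le> j"
proof (rule ccontr)
  assume "\<not> i \<le> j"
  then have ji: "j < i" by simp
  define E F K where "E = (proj n i :: 'a mat)" and "F = (coproj n i :: 'a mat)" and "K = (proj n j :: 'a mat)"
  have c: "E \<in> carrier_mat n n" "F \<in> carrier_mat n n" "K \<in> carrier_mat n n"
    by (simp_all add: E_def F_def K_def)
  have KF: "K * F = 0\<^sub>m n n" "F * K = 0\<^sub>m n n"
    using ji unfolding K_def F_def proj_def coproj_def mat_diag_zero[symmetric]
    by (auto intro!: mat_diag_cong)
  have KK: "K * K = K" and EE: "E * E = E" "E * F = 0\<^sub>m n n" "F * E = 0\<^sub>m n n" "F * F = F" "E + F = 1\<^sub>m n"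
    by (simp_all add: K_def E_def F_def)
  \<comment> \<open>Here \<open>K\<close> has rank \<open>j < i\<close>, and the summand \<open>F\<close> is the padding.\<close>
  let ?L = "E * A * K + F" and ?R = "K * B * E + F"
  have L: "?L \<in> carrier_mat n n" and R: "?R \<in> carrier_mat n n"
    using A B c by (simp_all add: square_mat_simps[where n=n])
  have KX: "K * (K * X) = K * X" "K * (F * X) = 0\<^sub>m n n" "F * (K * X) = 0\<^sub>m n n" "F * (E * X) = 0\<^sub>m n n"
    if "X \<in> carrier_mat n n" for X
    using that c KK KF EE
    by (simp_all add: square_mat_simps(4)[where n=n, OF _ _ that, symmetric] del: assoc_mult_mat)
  have "?L * ?R = E * (A * (K * (B * E))) + F"
    using A B c KK KF EE KX by (simp add: square_mat_simps[where n=n])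
  also have "E * (A * (K * (B * E))) = E * (A * K * B) * E"
    using A B c by (simp add: square_mat_simps[where n=n])
  also have "\<dots> = E" using eq EE by (simp add: E_def K_def)
  finally have "?L * ?R = 1\<^sub>m n" using EE by simp
  then have "det ?L \<noteq> 0" using inverse_nonzero_det[OF L R] by simp
  moreover have "det ?L = 0"
  proof -
    have jn: "j < n" using ji \<open>i \<le> n\<close> by simp
    have "?L *\<^sub>v unit_vec n j = E * A *\<^sub>v (K *\<^sub>v unit_vec n j) + F *\<^sub>v unit_vec n j"
      using A c by (simp add: add_mult_distrib_mat_vec[of _ n n] square_mat_simps[where n=n] assoc_mult_mat_vec[of _ n n _ n])
    also have "K *\<^sub>v unit_vec n j = 0\<^sub>v n"
      by (rule eq_vecI) (auto simp: K_def proj_def mat_diag_def jn)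
    also have "F *\<^sub>v unit_vec n j = 0\<^sub>v n"
      using ji by (intro eq_vecI) (auto simp: F_def coproj_def mat_diag_def jn)
    finally have "?L *\<^sub>v unit_vec n j = E * A *\<^sub>v 0\<^sub>v n + 0\<^sub>v n" .
    moreover have "X *\<^sub>v 0\<^sub>v n = 0\<^sub>v n" if "X \<in> carrier_mat n n" for X :: "'a mat"
      using that by (intro eq_vecI) auto
    ultimately have "?L *\<^sub>v unit_vec n j = 0\<^sub>v n" using A c by (simp add: square_mat_simps[where n=n])
    moreover have "unit_vec n j \<noteq> (0\<^sub>v n :: 'a vec)" using jn by simp
    ultimately show ?thesis using det_0_iff_vec_prod_zero_field[OF L] unit_vec_carrier by blast
  qed
  ultimately show False by simp
qed

lemma pivot_at_corner:
  fixes M :: "'a::field mat"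
  assumes M: "M \<in> carrier_mat (Suc n) (Suc n)" and "M \<noteq> 0\<^sub>m (Suc n) (Suc n)"
  obtains U V where "U \<in> carrier_mat (Suc n) (Suc n)" "V \<in> carrier_mat (Suc n) (Suc n)"
    "det U \<noteq> 0" "det V \<noteq> 0" "(U * M * V) $$ (0, 0) \<noteq> 0"
proof -
  obtain i j where ij: "i < Suc n" "j < Suc n" "M $$ (i, j) \<noteq> 0"
  proof (rule ccontr)
    assume "\<not> thesis"
    then have "M = 0\<^sub>m (Suc n) (Suc n)" using that M by (intro eq_matI) auto
    with assms(2) show False by simp
  qed
  let ?S = "\<lambda>k. swaprows_mat (Suc n) 0 k :: 'a mat"
  have det: "det (?S k) \<noteq> 0" if "k < Suc n" for k
    using inverse_nonzero_det(1)[OF swaprows_mat_carrier swaprows_mat_carrier swaprows_mat_inv[of 0 "Suc n" k]] that by simp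
  have "?S i * M = swaprows 0 i M" using swaprows_mat[OF M] ij by simp
  moreover have "swaprows 0 i M * ?S j = swapcols 0 j (swaprows 0 i M)"
    using swapcols_mat[of "swaprows 0 i M" "Suc n" "Suc n" 0 j] M ij by simp
  ultimately have "(?S i * M * ?S j) $$ (0, 0) = M $$ (i, j)" using ij M by simp
  with det ij show thesis by (intro that[of "?S i" "?S j"]) simp_all
qed

lemma proj_blk:
  "four_block_mat (1\<^sub>m 1) (0\<^sub>m 1 n) (0\<^sub>m n 1) (proj n r) = proj (Suc n) (Suc r)"
  by (rule eq_matI) (auto simp: proj_def mat_diag_def)

text \<open>Gaussian elimination on rows and columns: move a nonzero entry to the corner, clear its row and its
  column, and apply induction to the remaining block.\<close>

theorem rank_normal_form:
  fixes M :: "'a::field mat"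
  assumes "M \<in> carrier_mat n n"
  shows "\<exists>U V r. U \<in> carrier_mat n n \<and> V \<in> carrier_mat n n \<and> det U \<noteq> 0 \<and> det V \<noteq> 0 \<and> r \<le> n
    \<and> U * M * V = proj n r"
  using assms
proof (induction n arbitrary: M)
  case 0
  then show ?case
    by (intro exI[of _ "1\<^sub>m 0"] exI[of _ "0::nat"]) (auto intro!: eq_matI simp: proj_def mat_diag_def)
next
  case (Suc n M)
  show ?case
  proof (cases "M = 0\<^sub>m (Suc n) (Suc n)")
    case True
    then show ?thesis
      by (intro exI[of _ "1\<^sub>m (Suc n)"] exI[of _ "0::nat"]) (auto simp: proj_def mat_diag_zero)
  next
    case False
    then obtain S T where ST: "S \<in> carrier_mat (Suc n) (Suc n)" "T \<in> carrier_mat (Suc n) (Suc n)"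
      "det S \<noteq> 0" "det T \<noteq> 0" and piv: "(S * M * T) $$ (0, 0) \<noteq> 0"
      using pivot_at_corner[OF Suc.prems] by metis
    define N where "N = S * M * T"
    have N: "N \<in> carrier_mat (Suc n) (Suc n)" using ST Suc.prems by (simp add: N_def square_mat_simps[where n="Suc n"])
    define a where "a = N $$ (0, 0)"
    have a: "a \<noteq> 0" using piv by (simp add: a_def N_def)
    obtain A b c D where s: "split_block N 1 1 = (A, b, c, D)" using prod_cases4 by blast
    have blocks: "A \<in> carrier_mat 1 1" "b \<in> carrier_mat 1 n" "c \<in> carrier_mat n 1" "D \<in> carrier_mat n n"
      and Nblk: "N = four_block_mat A b c D"
      using split_block[OF s, of n n] N by auto
    have A: "A = a \<cdot>\<^sub>m 1\<^sub>m 1"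
      using blocks by (intro eq_matI) (auto simp: a_def Nblk)
    define i where "i = inverse a"
    have ia: "i * a = 1" "a * i = 1" using a by (simp_all add: i_def)
    \<comment> \<open>Left multiplication by \<open>L\<close> scales the pivot to one and clears its column; \<open>R\<close> clears its row.\<close>
    define L where "L = four_block_mat (i \<cdot>\<^sub>m 1\<^sub>m 1) (0\<^sub>m 1 n) ((- i) \<cdot>\<^sub>m c) (1\<^sub>m n)"
    define R where "R = four_block_mat (1\<^sub>m 1) ((- i) \<cdot>\<^sub>m b) (0\<^sub>m n 1) (1\<^sub>m n)"
    define D' where "D' = (- i) \<cdot>\<^sub>m (c * b) + D"
    have D': "D' \<in> carrier_mat n n" using blocks by (simp add: D'_def)
    have LR: "L \<in> carrier_mat (Suc n) (Suc n)" "R \<in> carrier_mat (Suc n) (Suc n)"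
      unfolding L_def R_def using four_block_carrier_mat[of _ 1 1 _ n n] by auto
    have dL: "det L \<noteq> 0"
      unfolding L_def using a blocks
      by (subst det_four_block_mat_upper_right_zero[of _ 1 _ n]) (auto simp: i_def)
    have dR: "det R \<noteq> 0"
      unfolding R_def using blocks
      by (subst det_four_block_mat_lower_left_zero[of _ 1 _ n]) auto
    have LN: "L * N = four_block_mat (1\<^sub>m 1) (i \<cdot>\<^sub>m b) (0\<^sub>m n 1) D'"
    proof -
      have "L * N = four_block_mat ((i \<cdot>\<^sub>m 1\<^sub>m 1) * A + 0\<^sub>m 1 n * c) ((i \<cdot>\<^sub>m 1\<^sub>m 1) * b + 0\<^sub>m 1 n * D)
          ((- i) \<cdot>\<^sub>m c * A + 1\<^sub>m n * c) ((- i) \<cdot>\<^sub>m c * b + 1\<^sub>m n * D)"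
        unfolding L_def Nblk using blocks by (intro mult_four_block_mat) auto
      also have "(i \<cdot>\<^sub>m 1\<^sub>m 1) * A + 0\<^sub>m 1 n * c = 1\<^sub>m 1"
        using blocks by (intro eq_matI) (auto simp: A ia)
      also have "(i \<cdot>\<^sub>m 1\<^sub>m 1) * b + 0\<^sub>m 1 n * D = i \<cdot>\<^sub>m b"
        using blocks by (simp add: mult_smult_assoc_mat[of _ 1 1])
      also have "(- i) \<cdot>\<^sub>m c * A + 1\<^sub>m n * c = 0\<^sub>m n 1"
        using blocks ia by (intro eq_matI) (auto simp: A scalar_prod_def mult.commute)
      also have "(- i) \<cdot>\<^sub>m c * b + 1\<^sub>m n * D = D'"
        using blocks by (simp add: D'_def mult_smult_assoc_mat[of _ n 1])
      finally show ?thesis .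
    qed
    have LNR: "L * N * R = four_block_mat (1\<^sub>m 1) (0\<^sub>m 1 n) (0\<^sub>m n 1) D'"
    proof -
      have "L * N * R = four_block_mat (1\<^sub>m 1 * 1\<^sub>m 1 + (i \<cdot>\<^sub>m b) * 0\<^sub>m n 1) (1\<^sub>m 1 * ((- i) \<cdot>\<^sub>m b) + (i \<cdot>\<^sub>m b) * 1\<^sub>m n)
          (0\<^sub>m n 1 * 1\<^sub>m 1 + D' * 0\<^sub>m n 1) (0\<^sub>m n 1 * ((- i) \<cdot>\<^sub>m b) + D' * 1\<^sub>m n)"
        unfolding LN R_def using blocks D' by (intro mult_four_block_mat) auto
      also have "1\<^sub>m 1 * ((- i) \<cdot>\<^sub>m b) + (i \<cdot>\<^sub>m b) * 1\<^sub>m n = 0\<^sub>m 1 n"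
        using blocks by (intro eq_matI) auto
      finally show ?thesis using blocks D' by simp
    qed
    obtain U' V' r where IH: "U' \<in> carrier_mat n n" "V' \<in> carrier_mat n n" "det U' \<noteq> 0" "det V' \<noteq> 0"
      "r \<le> n" "U' * D' * V' = proj n r"
      using Suc.IH[OF D'] by blast
    let ?U = "four_block_mat (1\<^sub>m 1) (0\<^sub>m 1 n) (0\<^sub>m n 1) U'"
    let ?V = "four_block_mat (1\<^sub>m 1) (0\<^sub>m 1 n) (0\<^sub>m n 1) V'"
    have UV: "?U \<in> carrier_mat (Suc n) (Suc n)" "?V \<in> carrier_mat (Suc n) (Suc n)"
      using four_block_carrier_mat[of _ 1 1 _ n n] IH by auto
    have dUV: "det ?U \<noteq> 0" "det ?V \<noteq> 0"
      using IH by (subst det_four_block_mat_lower_left_zero[of _ 1 _ n]; auto)+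
    have "?U * (L * N * R) = four_block_mat (1\<^sub>m 1) (0\<^sub>m 1 n) (0\<^sub>m n 1) (U' * D')"
      unfolding LNR using IH D' by (subst mult_four_block_mat[of _ 1 1 _ n _ n]) auto
    then have "?U * (L * N * R) * ?V = four_block_mat (1\<^sub>m 1) (0\<^sub>m 1 n) (0\<^sub>m n 1) (proj n r)"
      using IH D' by (simp, subst mult_four_block_mat[of _ 1 1 _ n _ n]) auto
    then have "?U * (L * N * R) * ?V = proj (Suc n) (Suc r)" by (simp only: proj_blk)
    then have "(?U * L * S) * M * (T * R * ?V) = proj (Suc n) (Suc r)"
      using UV LR ST Suc.prems by (simp add: N_def square_mat_simps[where n="Suc n"])
    moreover have "det (?U * L * S) \<noteq> 0" "det (T * R * ?V) \<noteq> 0"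
      using UV LR ST dUV dL dR by (simp_all add: det_mult[of _ "Suc n"] square_mat_simps[where n="Suc n"])
    moreover have "?U * L * S \<in> carrier_mat (Suc n) (Suc n)" "T * R * ?V \<in> carrier_mat (Suc n) (Suc n)"
      using UV LR ST by (simp_all add: square_mat_simps[where n="Suc n"])
    moreover have "Suc r \<le> Suc n" using IH by simp
    ultimately show ?thesis by blast
  qed
qed

text \<open>Padding a diagonal block by the identity does not change its determinant and keeps all matrices of
  the same size.\<close>

lemma det_block_triangular:
  fixes D :: "'a::field mat"
  assumes D: "D \<in> carrier_mat n n" and tri: "coproj n r * D * proj n r = 0\<^sub>m n n"
  shows "det D = det (proj n r * D * proj n r + coproj n r) * det (coproj n r * D * coproj n r + proj n r)"
proof -
  define E F where "E = (proj n r :: 'a mat)" and "F = (coproj n r :: 'a mat)"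
  have c: "E \<in> carrier_mat n n" "F \<in> carrier_mat n n" by (simp_all add: E_def F_def)
  have EF: "E * E = E" "E * F = 0\<^sub>m n n" "F * E = 0\<^sub>m n n" "F * F = F" "E + F = 1\<^sub>m n" "F + E = 1\<^sub>m n"
    by (simp_all add: E_def F_def)
  have absorb: "E * (E * X) = E * X" "F * (F * X) = F * X" "E * (F * X) = 0\<^sub>m n n" "F * (E * X) = 0\<^sub>m n n"
    if "X \<in> carrier_mat n n" for X
    using that by (simp_all add: E_def F_def)
  have FDE: "F * (D * E) = 0\<^sub>m n n" using tri D c by (simp add: E_def F_def square_mat_simps[where n=n])
  \<comment> \<open>The factorization is \<open>D = (F D F + E) (1 + E D F) (E D E + F)\<close>, with a unitriangular middle factor.\<close>
  let ?N = "1\<^sub>m n + E * (D * F)"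
  have N: "?N \<in> carrier_mat n n" using D c by (simp add: square_mat_simps[where n=n])
  have ents: "(E * (D * F)) $$ (i, j) = 0" if "i < n" "j < n" "j \<le> i" for i j
    using that D by (simp add: E_def F_def proj_def coproj_def mat_diag_mult_left[of _ n n] mat_diag_mult_right[of _ n n])
  have "upper_triangular ?N"
    unfolding upper_triangular_def using ents D c N by auto
  then have "det ?N = prod_list (diag_mat ?N)" using det_upper_triangular N by blast
  also have "diag_mat ?N = map (\<lambda>i. 1) [0..<n]"
    unfolding diag_mat_def using ents D c N by auto
  finally have dN: "det ?N = 1" by (simp add: map_replicate_const)
  have EDE: "E * D * E + F \<in> carrier_mat n n" and FDF: "F * D * F + E \<in> carrier_mat n n"
    using D c by (simp_all add: square_mat_simps[where n=n])
  have "?N * (E * D * E + F) = E * (D * E) + F + E * (D * F)"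
    using D c EF absorb FDE by (simp add: square_mat_simps[where n=n])
  then have "(F * D * F + E) * (?N * (E * D * E + F)) = E * (D * E) + (F * (D * F) + E * (D * F))"
    using D c EF absorb by (simp add: square_mat_simps[where n=n])
  also have "\<dots> = (E + F) * (D * (E + F))"
    using D c FDE comm_add_mat[of "F * (D * F)" n n "E * (D * F)"] by (simp add: square_mat_simps[where n=n])
  also have "\<dots> = D" using D EF by simp
  finally have "det D = det (F * D * F + E) * (det ?N * det (E * D * E + F))"
    using EDE FDF N by (metis det_mult square_mat_simps(1))
  then have "det D = det (E * D * E + F) * det (F * D * F + E)"
    by (simp only: dN mult_1_left mult.commute)
  then show ?thesis unfolding E_def F_def .
qed

section \<open>The six families\<close>

text \<open>The families that are defined by a form \<open>J\<close> are treated together: they differ in the sign \<open>eps\<close> and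
  in the factors by which the form may be scaled.\<close>

definition form_family :: "group_family \<Rightarrow> bool" where
  "form_family X \<longleftrightarrow> X \<in> {GO, Ort, GSp, Sp}"

definition factor_ok :: "group_family \<Rightarrow> 'a::field \<Rightarrow> bool" where
  "factor_ok X l \<longleftrightarrow> l \<noteq> 0 \<and> (X \<in> {Ort, Sp} \<longrightarrow> l = 1)"

lemma family_cases:
  obtains "X = GL" | "X = SL" | "form_family X"
  by (cases X) (auto simp: form_family_def)

lemma eps_square [simp]: "eps X * eps X = (1 :: 'a::field)"
  by (auto simp: eps_def)

lemma J_carrier [simp]: "J_mat X n \<in> carrier_mat (2 * n) (2 * n)"
  unfolding J_mat_def by (intro blk_carrier) auto

lemma G_set_form_iff:
  assumes "form_family X"
  shows "g \<in> G_set X n \<longleftrightarrow> g \<in> carrier_mat (2 * n) (2 * n) \<and> det g \<noteq> 0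
    \<and> (\<exists>l. factor_ok X l \<and> g\<^sup>T * J_mat X n * g = l \<cdot>\<^sub>m J_mat X n)"
  using assms by (cases X) (simp_all add: form_family_def factor_ok_def GL_set_iff)

lemma G_set_carrier:
  assumes "g \<in> G_set X n"
  shows "g \<in> carrier_mat (2 * n) (2 * n)" and "det g \<noteq> 0"
  using assms by (cases X; auto simp: GL_set_iff)+

lemma G_set_mult:
  assumes g: "g \<in> G_set X n" and h: "h \<in> G_set X n"
  shows "g * h \<in> G_set X n"
proof -
  note c = G_set_carrier(1)[OF g] G_set_carrier(1)[OF h]
  have gh: "g * h \<in> carrier_mat (2 * n) (2 * n)" and d: "det (g * h) = det g * det h"
    using c det_mult by auto
  have d0: "det (g * h) \<noteq> 0" using d G_set_carrier(2)[OF g] G_set_carrier(2)[OF h] by simp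
  show ?thesis
  proof (cases X rule: family_cases)
    case 1
    then show ?thesis using gh d0 by (simp add: GL_set_iff)
  next
    case 2
    then show ?thesis using gh d0 d g h by (simp add: GL_set_iff)
  next
    case 3
    let ?J = "J_mat X n :: 'a mat"
    obtain l m where l: "factor_ok X l" "g\<^sup>T * ?J * g = l \<cdot>\<^sub>m ?J" and m: "factor_ok X m" "h\<^sup>T * ?J * h = m \<cdot>\<^sub>m ?J"
      using g h unfolding G_set_form_iff[OF 3] by blast
    have "(g * h)\<^sup>T * ?J * (g * h) = h\<^sup>T * (g\<^sup>T * ?J * g) * h"
      using c by (simp add: square_mat_simps[where n = "2 * n"])
    also have "\<dots> = l \<cdot>\<^sub>m (h\<^sup>T * ?J * h)"
      unfolding l(2) using c by (simp add: square_mat_simps[where n = "2 * n"])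
    also have "\<dots> = (l * m) \<cdot>\<^sub>m ?J" unfolding m(2) by (rule smult_smult_mat)
    finally have "(g * h)\<^sup>T * ?J * (g * h) = (l * m) \<cdot>\<^sub>m ?J" .
    moreover have "factor_ok X (l * m)" using l(1) m(1) by (auto simp: factor_ok_def)
    ultimately show ?thesis unfolding G_set_form_iff[OF 3] using gh d0 by blast
  qed
qed

lemma G_set_one: "1\<^sub>m (2 * n) \<in> G_set X n"
proof (cases X rule: family_cases)
  case 3
  have "factor_ok X (1 :: 'a)" by (simp add: factor_ok_def)
  moreover have "(1\<^sub>m (2 * n))\<^sup>T * J_mat X n * 1\<^sub>m (2 * n) = 1 \<cdot>\<^sub>m (J_mat X n :: 'a mat)"
    by (simp add: square_mat_simps[where n = "2 * n"])
  ultimately show ?thesis unfolding G_set_form_iff[OF 3] by auto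
qed (simp_all add: GL_set_iff)

lemma G_set_inverse:
  assumes g: "g \<in> G_set X n"
  obtains h where "h \<in> G_set X n" "h * g = 1\<^sub>m (2 * n)" "g * h = 1\<^sub>m (2 * n)"
proof -
  note c = G_set_carrier[OF g]
  obtain h where h: "h \<in> carrier_mat (2 * n) (2 * n)" "g * h = 1\<^sub>m (2 * n)" "h * g = 1\<^sub>m (2 * n)"
    using nonzero_det_inverse[OF c] .
  note d = inverse_nonzero_det[OF c(1) h(1,2)]
  have "h \<in> G_set X n"
  proof (cases X rule: family_cases)
    case 1
    then show ?thesis using h d by (simp add: GL_set_iff)
  next
    case 2
    then show ?thesis using h d g by (simp add: GL_set_iff)
  next
    case 3
    let ?J = "J_mat X n :: 'a mat"
    obtain l where l: "factor_ok X l" "g\<^sup>T * ?J * g = l \<cdot>\<^sub>m ?J"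
      using g unfolding G_set_form_iff[OF 3] by blast
    have "l \<cdot>\<^sub>m (h\<^sup>T * ?J * h) = h\<^sup>T * (g\<^sup>T * ?J * g) * h"
      unfolding l(2) using h by (simp add: square_mat_simps[where n = "2 * n"])
    also have "\<dots> = (g * h)\<^sup>T * ?J * (g * h)"
      using c(1) h(1) by (simp add: square_mat_simps[where n = "2 * n"])
    also have "\<dots> = ?J" unfolding h(2) by (simp add: square_mat_simps[where n = "2 * n"])
    finally have "h\<^sup>T * ?J * h = inverse l \<cdot>\<^sub>m ?J"
      using l(1) smult_smult_mat[of "inverse l" l "h\<^sup>T * ?J * h"] by (simp add: factor_ok_def)
    moreover have "factor_ok X (inverse l)" using l(1) by (auto simp: factor_ok_def)
    ultimately show ?thesis unfolding G_set_form_iff[OF 3] using h d by blast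
  qed
  then show thesis using that h by blast
qed

lemma G_grp_simps [simp]:
  "carrier (G_grp X n) = G_set X n" "mult (G_grp X n) = (*)" "one (G_grp X n) = 1\<^sub>m (2 * n)"
  by (simp_all add: G_grp_def)

lemma group_G_grp: "group (G_grp X n)"
proof (rule groupI; simp)
  fix g h k :: "'a mat" assume "g \<in> G_set X n" "h \<in> G_set X n" "k \<in> G_set X n"
  then show "g * h * k = g * (h * k)" using G_set_carrier(1) assoc_mult_mat by blast
next
  fix g :: "'a mat" assume g: "g \<in> G_set X n"
  then show "1\<^sub>m (2 * n) * g = g" using G_set_carrier(1) left_mult_one_mat by blast
  show "\<exists>h\<in>G_set X n. h * g = 1\<^sub>m (2 * n)" using G_set_inverse[OF g] by metis
qed (simp_all add: G_set_mult G_set_one)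

lemma finite_carrier_mat: "finite (carrier_mat nr nc :: 'a::finite mat set)"
proof -
  let ?D = "{..<nr} \<times> {..<nc}"
  have "A \<in> mat nr nc ` (?D \<rightarrow>\<^sub>E UNIV)" if A: "A \<in> carrier_mat nr nc" for A :: "'a mat"
  proof
    show "A = mat nr nc (restrict (\<lambda>ij. A $$ ij) ?D)" using A by (intro eq_matI) auto
  qed simp
  then have "carrier_mat nr nc \<subseteq> mat nr nc ` (?D \<rightarrow>\<^sub>E (UNIV :: 'a set))" by blast
  moreover have "finite (?D \<rightarrow>\<^sub>E (UNIV :: 'a set))" by (intro finite_PiE) auto
  ultimately show ?thesis using finite_surj by blast
qed

lemma finite_G_set: "finite (G_set X n :: 'a::{field,finite} mat set)"
  using finite_subset[OF _ finite_carrier_mat] G_set_carrier(1) by blast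

section \<open>The Siegel parabolic\<close>

lemma P_set_G_set: "p \<in> P_set X n \<Longrightarrow> p \<in> G_set X n"
  by (simp add: P_set_def)

lemma P_setI:
  "four_block_mat A B (0\<^sub>m n n) D \<in> G_set X n \<Longrightarrow> A \<in> carrier_mat n n \<Longrightarrow> B \<in> carrier_mat n n \<Longrightarrow>
    D \<in> carrier_mat n n \<Longrightarrow> four_block_mat A B (0\<^sub>m n n) D \<in> P_set X n"
  unfolding P_set_def by blast

lemma P_setE:
  fixes p :: "'a::field mat"
  assumes "p \<in> P_set X n"
  obtains A B D where "A \<in> carrier_mat n n" "B \<in> carrier_mat n n" "D \<in> carrier_mat n n"
    "p = four_block_mat A B (0\<^sub>m n n) D" "det p = det A * det D" "det A \<noteq> 0" "det D \<noteq> 0"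
proof -
  obtain A B D where c: "A \<in> carrier_mat n n" "B \<in> carrier_mat n n" "D \<in> carrier_mat n n"
    and p: "p = four_block_mat A B (0\<^sub>m n n) D" using assms by (auto simp: P_set_def)
  have "det p = det A * det D"
    unfolding p using c by (intro det_four_block_mat_lower_left_zero) auto
  moreover have "det p \<noteq> 0" using assms G_set_carrier(2) P_set_G_set by blast
  ultimately show thesis using that c p by auto
qed

lemmas mult_blk = mult_four_block_mat[of _ n n _ n _ n _ _ n _ n for n]

lemma subgroup_P_set: "subgroup (P_set X n) (G_grp X n :: 'a::field mat monoid)"
proof (rule group.subgroupI[OF group_G_grp])
  show "P_set X n \<subseteq> carrier (G_grp X n)" by (auto simp: P_set_def)
  have "four_block_mat (1\<^sub>m n) (0\<^sub>m n n) (0\<^sub>m n n) (1\<^sub>m n) \<in> P_set X n"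
    using G_set_one[of n X] by (intro P_setI) (auto simp: mult_2)
  then show "P_set X n \<noteq> ({} :: 'a mat set)" by blast
next
  fix p q :: "'a mat" assume p: "p \<in> P_set X n" and q: "q \<in> P_set X n"
  obtain A B D where p': "A \<in> carrier_mat n n" "B \<in> carrier_mat n n" "D \<in> carrier_mat n n"
    "p = four_block_mat A B (0\<^sub>m n n) D" "det p = det A * det D" "det A \<noteq> 0" "det D \<noteq> 0"
    using p by (rule P_setE)
  obtain A' B' D' where q': "A' \<in> carrier_mat n n" "B' \<in> carrier_mat n n" "D' \<in> carrier_mat n n"
    "q = four_block_mat A' B' (0\<^sub>m n n) D'" "det q = det A' * det D'" "det A' \<noteq> 0" "det D' \<noteq> 0"
    using q by (rule P_setE)
  have "p * q = four_block_mat (A * A') (A * B' + B * D') (0\<^sub>m n n) (D * D')"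
    unfolding p'(4) q'(4) using p' q' by (subst mult_blk[where n = n]) (auto simp: square_mat_simps[where n = n])
  moreover have "p * q \<in> G_set X n" using p q by (intro G_set_mult P_set_G_set)
  ultimately show "p \<otimes>\<^bsub>G_grp X n\<^esub> q \<in> P_set X n"
    using p' q' by (auto intro!: P_setI simp: square_mat_simps[where n = n])
next
  fix p :: "'a mat" assume p: "p \<in> P_set X n"
  define h where "h = inv\<^bsub>G_grp X n\<^esub> p"
  have h: "h \<in> G_set X n" "p * h = 1\<^sub>m (2 * n)"
    using group.inv_closed[OF group_G_grp, of p X n] group.r_inv[OF group_G_grp, of p X n] P_set_G_set[OF p]
    by (simp_all add: h_def)
  obtain A B D where p': "A \<in> carrier_mat n n" "B \<in> carrier_mat n n" "D \<in> carrier_mat n n"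
    "p = four_block_mat A B (0\<^sub>m n n) D" "det p = det A * det D" "det A \<noteq> 0" "det D \<noteq> 0"
    using p by (rule P_setE)
  obtain A' B' C' D' where h': "A' \<in> carrier_mat n n" "B' \<in> carrier_mat n n" "C' \<in> carrier_mat n n"
    "D' \<in> carrier_mat n n" "h = four_block_mat A' B' C' D'"
    using G_set_carrier(1)[OF h(1)] by (rule four_blocksE)
  have "four_block_mat (A * A' + B * C') (A * B' + B * D') (0\<^sub>m n n * A' + D * C') (0\<^sub>m n n * B' + D * D')
      = four_block_mat (1\<^sub>m n) (0\<^sub>m n n) (0\<^sub>m n n) (1\<^sub>m n)"
    using h(2) p' h' by (simp add: mult_blk[where n = n] mult_2)
  then have "D * C' = 0\<^sub>m n n"
    using p' h' by (subst (asm) blk_eq_iff[of _ n]) (auto simp: square_mat_simps[where n = n])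
  then have DC: "D * C' = 0\<^sub>m n n" .
  obtain E where E: "E \<in> carrier_mat n n" "E * D = 1\<^sub>m n"
    using nonzero_det_inverse[OF p'(3,7)] by metis
  have "C' = E * D * C'" using E h' by simp
  also have "\<dots> = E * (D * C')" using E(1) p' h' by (intro assoc_mult_mat) auto
  also have "\<dots> = 0\<^sub>m n n" unfolding DC using E by simp
  finally have "C' = 0\<^sub>m n n" .
  then show "inv\<^bsub>G_grp X n\<^esub> p \<in> P_set X n"
    using h h' unfolding h_def[symmetric] by (auto intro: P_setI)
qed

section \<open>Block equations of the form groups\<close>

text \<open>Once \<open>C\<close> is a coordinate projection, the first equation says that a block of \<open>A\<close> is symmetric or
  skew-symmetric, which is the symmetry of the upper right block of a unipotent element.\<close>

lemma form_blk_iff: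
  fixes A B C D :: "'a::field mat"
  assumes "A \<in> carrier_mat n n" "B \<in> carrier_mat n n" "C \<in> carrier_mat n n" "D \<in> carrier_mat n n"
  shows "(four_block_mat A B C D)\<^sup>T * J_mat X n * four_block_mat A B C D = l \<cdot>\<^sub>m J_mat X n \<longleftrightarrow>
    eps X \<cdot>\<^sub>m (A\<^sup>T * C) + C\<^sup>T * A = 0\<^sub>m n n \<and> eps X \<cdot>\<^sub>m (A\<^sup>T * D) + C\<^sup>T * B = (l * eps X) \<cdot>\<^sub>m 1\<^sub>m n
    \<and> eps X \<cdot>\<^sub>m (B\<^sup>T * C) + D\<^sup>T * A = l \<cdot>\<^sub>m 1\<^sub>m n \<and> eps X \<cdot>\<^sub>m (B\<^sup>T * D) + D\<^sup>T * B = 0\<^sub>m n n"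
proof -
  note sm = square_mat_simps[where n = n] and sm2 = square_mat_simps[where n = "2 * n"]
  let ?g = "four_block_mat A B C D" and ?J = "J_mat X n :: 'a mat"
  have g: "?g \<in> carrier_mat (2 * n) (2 * n)" using assms by (simp add: blk_carrier)
  have Jg: "?J * ?g = four_block_mat (eps X \<cdot>\<^sub>m C) (eps X \<cdot>\<^sub>m D) A B"
    unfolding J_mat_def using assms by (subst mult_blk[where n = n]) (auto simp: sm)
  have gT: "?g\<^sup>T = four_block_mat A\<^sup>T C\<^sup>T B\<^sup>T D\<^sup>T"
    using assms by (rule transpose_four_block_mat)
  have "?g\<^sup>T * ?J * ?g = ?g\<^sup>T * (?J * ?g)" using g by (simp add: sm2)
  also have "\<dots> = four_block_mat (eps X \<cdot>\<^sub>m (A\<^sup>T * C) + C\<^sup>T * A) (eps X \<cdot>\<^sub>m (A\<^sup>T * D) + C\<^sup>T * B)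
      (eps X \<cdot>\<^sub>m (B\<^sup>T * C) + D\<^sup>T * A) (eps X \<cdot>\<^sub>m (B\<^sup>T * D) + D\<^sup>T * B)"
    unfolding Jg gT using assms by (subst mult_blk[where n = n]) (auto simp: sm)
  finally have L: "?g\<^sup>T * ?J * ?g = \<dots>" .
  have R: "l \<cdot>\<^sub>m ?J = four_block_mat (0\<^sub>m n n) ((l * eps X) \<cdot>\<^sub>m 1\<^sub>m n) (l \<cdot>\<^sub>m 1\<^sub>m n) (0\<^sub>m n n)"
    unfolding J_mat_def by (subst smult_four_block_mat[of _ n n _ n _ n]) (auto simp: smult_smult_mat)
  show ?thesis unfolding L R using assms by (subst blk_eq_iff[of _ n]) (auto simp: sm)
qed

lemma form_upper_iff:
  fixes A B D :: "'a::field mat"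
  assumes "A \<in> carrier_mat n n" "B \<in> carrier_mat n n" "D \<in> carrier_mat n n"
  shows "(four_block_mat A B (0\<^sub>m n n) D)\<^sup>T * J_mat X n * four_block_mat A B (0\<^sub>m n n) D = l \<cdot>\<^sub>m J_mat X n \<longleftrightarrow>
    D\<^sup>T * A = l \<cdot>\<^sub>m 1\<^sub>m n \<and> eps X \<cdot>\<^sub>m (B\<^sup>T * D) + D\<^sup>T * B = 0\<^sub>m n n"
proof -
  note sm = square_mat_simps[where n = n]
  have "eps X \<cdot>\<^sub>m (A\<^sup>T * D) = (l * eps X) \<cdot>\<^sub>m 1\<^sub>m n" if "D\<^sup>T * A = l \<cdot>\<^sub>m 1\<^sub>m n"
  proof -
    have "A\<^sup>T * D = (D\<^sup>T * A)\<^sup>T" using assms by (simp add: sm)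
    then show ?thesis unfolding that by (simp add: transpose_smult smult_smult_mat mult.commute)
  qed
  then show ?thesis using assms by (subst form_blk_iff) (auto simp: sm)
qed

lemma det_upper_blk:
  fixes A B D :: "'a::field mat"
  assumes "A \<in> carrier_mat n n" "B \<in> carrier_mat n n" "D \<in> carrier_mat n n"
  shows "det (four_block_mat A B (0\<^sub>m n n) D) = det A * det D"
  using assms by (intro det_four_block_mat_lower_left_zero) auto

lemma upper_blk_in_P_set:
  fixes A B D :: "'a::field mat"
  assumes X: "form_family X"
    and c: "A \<in> carrier_mat n n" "B \<in> carrier_mat n n" "D \<in> carrier_mat n n"
    and "det A \<noteq> 0" "det D \<noteq> 0" and l: "factor_ok X l" "D\<^sup>T * A = l \<cdot>\<^sub>m 1\<^sub>m n"
    and "eps X \<cdot>\<^sub>m (B\<^sup>T * D) + D\<^sup>T * B = 0\<^sub>m n n"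
  shows "four_block_mat A B (0\<^sub>m n n) D \<in> P_set X n"
proof (rule P_setI)
  let ?p = "four_block_mat A B (0\<^sub>m n n) D"
  have "?p \<in> carrier_mat (2 * n) (2 * n)" using c by (simp add: blk_carrier)
  moreover have "det ?p \<noteq> 0" using assms by (simp add: det_upper_blk[OF c])
  moreover have "?p\<^sup>T * J_mat X n * ?p = l \<cdot>\<^sub>m J_mat X n"
    unfolding form_upper_iff[OF c] using assms by blast
  ultimately show "?p \<in> G_set X n" unfolding G_set_form_iff[OF X] using l by blast
qed (use c in auto)

lemma levi_in_P_set:
  fixes U :: "'a::field mat"
  assumes X: "form_family X" and U: "U \<in> carrier_mat n n" "U' \<in> carrier_mat n n" "U' * U = 1\<^sub>m n"
  shows "four_block_mat U'\<^sup>T (0\<^sub>m n n) (0\<^sub>m n n) U \<in> P_set X n"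
proof (rule upper_blk_in_P_set[OF X])
  show "det U'\<^sup>T \<noteq> 0" "det U \<noteq> 0"
    using inverse_nonzero_det[OF U(2,1,3)] U by (simp_all add: det_transpose)
  have "U\<^sup>T * U'\<^sup>T = (U' * U)\<^sup>T" using U(1,2) by (simp add: square_mat_simps[where n = n])
  then show "U\<^sup>T * U'\<^sup>T = 1 \<cdot>\<^sub>m 1\<^sub>m n" by (simp only: U(3) transpose_one smult_one_mat)
qed (use U in \<open>auto simp: factor_ok_def square_mat_simps[where n = n]\<close>)

lemma unipotent_in_P_set:
  fixes Y :: "'a::field mat"
  assumes Y: "Y \<in> carrier_mat n n" and form: "form_family X \<Longrightarrow> eps X \<cdot>\<^sub>m Y\<^sup>T + Y = 0\<^sub>m n n"
  shows "four_block_mat (1\<^sub>m n) Y (0\<^sub>m n n) (1\<^sub>m n) \<in> P_set X n"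
proof (cases "form_family X")
  case True
  show ?thesis
    by (rule upper_blk_in_P_set[OF True, where l = 1])
      (use form[OF True] Y in \<open>auto simp: factor_ok_def square_mat_simps[where n = n]\<close>)
next
  case False
  have "det (four_block_mat (1\<^sub>m n) Y (0\<^sub>m n n) (1\<^sub>m n)) = 1"
    using Y by (simp add: det_upper_blk[of _ n])
  then have "four_block_mat (1\<^sub>m n) Y (0\<^sub>m n n) (1\<^sub>m n) \<in> G_set X n"
    using False by (cases X rule: family_cases) (simp_all add: GL_set_iff blk_carrier)
  then show ?thesis using Y by (intro P_setI) auto
qed

text \<open>For \<open>n = 0\<close> every nonzero scalar would do; from \<open>n \<ge> 1\<close> the top left entry of \<open>D\<^sup>T * A\<close> recovers \<open>l\<close>.\<close>

lemma similitude_eq: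
  fixes A B D :: "'a::field mat"
  assumes "n \<ge> 1" and c: "A \<in> carrier_mat n n" "B \<in> carrier_mat n n" "D \<in> carrier_mat n n"
    and l: "l \<noteq> 0" "D\<^sup>T * A = l \<cdot>\<^sub>m 1\<^sub>m n"
  shows "similitude n (four_block_mat A B (0\<^sub>m n n) D) = l"
  unfolding similitude_def
proof (rule the_equality, intro conjI)
  note sm = square_mat_simps[where n = n]
  have AD: "A\<^sup>T * D = l \<cdot>\<^sub>m 1\<^sub>m n"
  proof -
    have "A\<^sup>T * D = (D\<^sup>T * A)\<^sup>T" using c by (simp add: sm)
    then show ?thesis unfolding l(2) by (simp add: transpose_smult)
  qed
  let ?A = "inverse l \<cdot>\<^sub>m A"
  have A: "?A \<in> carrier_mat n n" using c by simp
  have "?A\<^sup>T * D = inverse l \<cdot>\<^sub>m (A\<^sup>T * D)" using c by (simp add: sm transpose_smult)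
  then have 1: "?A\<^sup>T * D = 1\<^sub>m n" unfolding AD using l by (simp add: smult_smult_mat)
  then have 2: "D * ?A\<^sup>T = 1\<^sub>m n" using mat_mult_left_right_inverse[of "?A\<^sup>T" n D] A c by simp
  have 3: "l \<cdot>\<^sub>m ?A = A" using l by (simp add: smult_smult_mat)
  show "\<exists>A'\<in>carrier_mat n n. \<exists>B'\<in>carrier_mat n n. \<exists>D'\<in>carrier_mat n n. inverts_mat A'\<^sup>T D' \<and> inverts_mat D' A'\<^sup>T \<and>
      four_block_mat A B (0\<^sub>m n n) D = four_block_mat (l \<cdot>\<^sub>m A') B' (0\<^sub>m n n) D'"
    using A c 1 2 3 by (intro bexI[of _ ?A] bexI[of _ B] bexI[of _ D]) (auto simp: inverts_mat_def)
  fix m assume "m \<noteq> 0 \<and> (\<exists>A'\<in>carrier_mat n n. \<exists>B'\<in>carrier_mat n n. \<exists>D'\<in>carrier_mat n n.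
      inverts_mat A'\<^sup>T D' \<and> inverts_mat D' A'\<^sup>T \<and>
      four_block_mat A B (0\<^sub>m n n) D = four_block_mat (m \<cdot>\<^sub>m A') B' (0\<^sub>m n n) D')"
  then obtain A' B' D' where c': "A' \<in> carrier_mat n n" "B' \<in> carrier_mat n n" "D' \<in> carrier_mat n n"
    and inv: "A'\<^sup>T * D' = 1\<^sub>m n" and eq: "four_block_mat A B (0\<^sub>m n n) D = four_block_mat (m \<cdot>\<^sub>m A') B' (0\<^sub>m n n) D'"
    by (auto simp: inverts_mat_def)
  have "A = m \<cdot>\<^sub>m A'" "D = D'"
    using eq c c' by (subst (asm) blk_eq_iff[of _ n]; simp)+
  then have "A\<^sup>T * D = m \<cdot>\<^sub>m (A'\<^sup>T * D')" using c c' by (simp add: sm transpose_smult)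
  then have "l \<cdot>\<^sub>m 1\<^sub>m n = m \<cdot>\<^sub>m (1\<^sub>m n :: 'a mat)" using inv AD by simp
  then have "(l \<cdot>\<^sub>m 1\<^sub>m n) $$ (0, 0) = (m \<cdot>\<^sub>m (1\<^sub>m n :: 'a mat)) $$ (0, 0)" by simp
  then show "m = l" using assms(1) by simp
qed (rule l)

section \<open>Double coset representatives\<close>

text \<open>The representative of rank \<open>r\<close> exchanges the \<open>i\<close>-th and the \<open>(n + i)\<close>-th coordinate for \<open>i < r\<close>, with
  the sign that preserves \<open>J\<close>, and fixes the other coordinates. The same matrices serve all six families.\<close>

definition weyl :: "group_family \<Rightarrow> nat \<Rightarrow> nat \<Rightarrow> 'a::field mat" where
  "weyl X n r = four_block_mat (coproj n r) (eps X \<cdot>\<^sub>m proj n r) (proj n r) (coproj n r)"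

definition weyl_inv :: "group_family \<Rightarrow> nat \<Rightarrow> nat \<Rightarrow> 'a::field mat" where
  "weyl_inv X n r = four_block_mat (coproj n r) (proj n r) (eps X \<cdot>\<^sub>m proj n r) (coproj n r)"

lemma weyl_carrier [simp]:
  "weyl X n r \<in> carrier_mat (2 * n) (2 * n)" "weyl_inv X n r \<in> carrier_mat (2 * n) (2 * n)"
  by (simp_all add: weyl_def weyl_inv_def blk_carrier)

lemma weyl_inverse: "weyl X n r * weyl_inv X n r = 1\<^sub>m (2 * n)"
  unfolding weyl_def weyl_inv_def
  by (subst mult_blk[where n = n]) (auto simp: square_mat_simps[where n = n] smult_smult_mat mult_2)

text \<open>In dimension two, the rotation with rows \<open>(0, -1)\<close> and \<open>(1, 0)\<close> is a product of three unipotent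
  matrices; the same factorization works blockwise.\<close>

lemma det_weyl:
  assumes "eps X = (- 1 :: 'a::field)"
  shows "det (weyl X n r :: 'a mat) = 1"
proof -
  note sm = square_mat_simps[where n = n]
  let ?E = "proj n r :: 'a mat" and ?F = "coproj n r :: 'a mat"
  let ?u = "four_block_mat (1\<^sub>m n) (- 1 \<cdot>\<^sub>m ?E) (0\<^sub>m n n) (1\<^sub>m n)"
  let ?l = "four_block_mat (1\<^sub>m n) (0\<^sub>m n n) ?E (1\<^sub>m n)"
  have E: "1\<^sub>m n + - 1 \<cdot>\<^sub>m ?E = ?F" "- 1 \<cdot>\<^sub>m ?E + 1\<^sub>m n = ?F"
    unfolding proj_def coproj_def mat_diag_one[symmetric]
    by (auto simp: mat_diag_add mat_diag_smult simp del: mat_diag_one intro!: mat_diag_cong)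
  have "?u * ?l = four_block_mat ?F (- 1 \<cdot>\<^sub>m ?E) ?E (1\<^sub>m n)"
    by (subst mult_blk[where n = n]) (auto simp: sm E)
  then have "?u * ?l * ?u = four_block_mat ?F (- 1 \<cdot>\<^sub>m ?E) ?E ?F"
    by (simp, subst mult_blk[where n = n]) (auto simp: sm E smult_smult_mat)
  then have "?u * ?l * ?u = weyl X n r" by (simp add: weyl_def assms)
  moreover have "det ?u = 1" by (simp add: det_upper_blk[of _ n])
  moreover have "det ?l = 1"
    by (subst det_four_block_mat_upper_right_zero[of _ n _ n]) auto
  moreover have "det (?u * ?l * ?u) = det ?u * det ?l * det ?u"
    by (simp add: det_mult[of _ "2 * n"] blk_carrier square_mat_simps[where n = "2 * n"])
  ultimately show ?thesis by simp
qed

lemma weyl_G_set: "weyl X n r \<in> G_set X n"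
proof (cases X rule: family_cases)
  case 1
  then show ?thesis
    using inverse_nonzero_det(1)[OF weyl_carrier weyl_inverse[of X n r]] by (simp add: GL_set_iff)
next
  case 2
  have "det (weyl X n r :: 'a mat) = 1" using 2 by (intro det_weyl) (simp add: eps_def)
  then show ?thesis using 2 by (simp add: GL_set_iff)
next
  case 3
  note sm = square_mat_simps[where n = n]
  let ?E = "proj n r :: 'a mat" and ?F = "coproj n r :: 'a mat"
  have "eps X \<cdot>\<^sub>m ?F + eps X \<cdot>\<^sub>m ?E = eps X \<cdot>\<^sub>m (?F + ?E)"
    by (subst add_smult_distrib_left_mat[of _ n n]) auto
  then have "(weyl X n r)\<^sup>T * J_mat X n * weyl X n r = 1 \<cdot>\<^sub>m (J_mat X n :: 'a mat)"
    unfolding weyl_def by (subst form_blk_iff) (auto simp: sm transpose_smult smult_smult_mat)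
  moreover have "factor_ok X (1 :: 'a)" by (simp add: factor_ok_def)
  ultimately show ?thesis
    unfolding G_set_form_iff[OF 3]
    using inverse_nonzero_det(1)[OF weyl_carrier weyl_inverse[of X n r]] weyl_carrier by blast
qed

lemma weyl_inv_G_set: "weyl_inv X n r \<in> G_set X n"
proof -
  obtain h where h: "h \<in> G_set X n" "h * weyl X n r = (1\<^sub>m (2 * n) :: 'a mat)"
    using G_set_inverse[OF weyl_G_set] by metis
  have "weyl_inv X n r = h * weyl X n r * weyl_inv X n r"
    unfolding h(2) by (simp add: square_mat_simps[where n = "2 * n"])
  also have "\<dots> = h * (weyl X n r * weyl_inv X n r)"
    using G_set_carrier(1)[OF h(1)] by (simp add: square_mat_simps[where n = "2 * n"])
  also have "\<dots> = h" unfolding weyl_inverse using G_set_carrier(1)[OF h(1)] by simp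
  finally show ?thesis using h(1) by simp
qed

lemma P_set_mult: "p \<in> P_set X n \<Longrightarrow> q \<in> P_set X n \<Longrightarrow> p * q \<in> P_set X n"
  using subgroup.m_closed[OF subgroup_P_set] by simp

lemma P_set_inverse:
  assumes "p \<in> P_set X n"
  obtains h where "h \<in> P_set X n" "h * p = 1\<^sub>m (2 * n)" "p * h = 1\<^sub>m (2 * n)"
proof -
  let ?G = "G_grp X n :: 'a mat monoid"
  have "inv\<^bsub>?G\<^esub> p \<in> P_set X n" using subgroup.m_inv_closed[OF subgroup_P_set assms] .
  moreover have "inv\<^bsub>?G\<^esub> p * p = 1\<^sub>m (2 * n)" "p * inv\<^bsub>?G\<^esub> p = 1\<^sub>m (2 * n)"
    using group.l_inv[OF group_G_grp, of p X n] group.r_inv[OF group_G_grp, of p X n] P_set_G_set[OF assms]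
    by simp_all
  ultimately show thesis using that by blast
qed

lemma P_set_carrier: "p \<in> P_set X n \<Longrightarrow> p \<in> carrier_mat (2 * n) (2 * n)"
  using G_set_carrier(1) P_set_G_set by blast

lemma double_coset_repI:
  assumes P: "p \<in> P_set X n" "q \<in> P_set X n" "q' \<in> P_set X n" and g: "g \<in> carrier_mat (2 * n) (2 * n)"
    and eq: "p * g * q = weyl X n r * q'"
  shows "\<exists>p\<in>P_set X n. \<exists>q\<in>P_set X n. g = p * weyl X n r * q"
proof -
  note sm = square_mat_simps[where n = "2 * n"]
  obtain p' where p': "p' \<in> P_set X n" "p' * p = 1\<^sub>m (2 * n)" using P_set_inverse[OF P(1)] by metis
  obtain q'' where q'': "q'' \<in> P_set X n" "q * q'' = 1\<^sub>m (2 * n)" using P_set_inverse[OF P(2)] by metis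
  note c = P[THEN P_set_carrier] p'(1)[THEN P_set_carrier] q''(1)[THEN P_set_carrier] g
  have "g = (p' * p) * g * (q * q'')" unfolding p' q'' using g by simp
  also have "\<dots> = p' * (p * g * q) * q''" using c by (simp add: sm)
  also have "\<dots> = p' * weyl X n r * (q' * q'')" unfolding eq using c by (simp add: sm)
  finally show ?thesis using p' q'' P P_set_mult by blast
qed

text \<open>The lower left block of \<open>weyl_inv X n r * g\<close> is \<open>eps X \<cdot>\<^sub>m (proj n r * A)\<close> plus a product of
  complementary projections, so the hypothesis on \<open>A\<close> is what places that matrix in the parabolic.\<close>

lemma double_coset_if_reduced:
  fixes A B D :: "'a::field mat"
  assumes c: "A \<in> carrier_mat n n" "B \<in> carrier_mat n n" "D \<in> carrier_mat n n"
    and g: "four_block_mat A B (proj n r) D \<in> G_set X n" and EA: "proj n r * A = 0\<^sub>m n n"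
  shows "\<exists>q\<in>P_set X n. four_block_mat A B (proj n r) D = weyl X n r * q"
proof
  note sm = square_mat_simps[where n = n]
  let ?g = "four_block_mat A B (proj n r) D"
  have gc: "?g \<in> carrier_mat (2 * n) (2 * n)" using c by (simp add: blk_carrier)
  have "weyl_inv X n r * ?g = four_block_mat (coproj n r * A + proj n r) (coproj n r * B + proj n r * D) (0\<^sub>m n n)
      (eps X \<cdot>\<^sub>m (proj n r * B) + coproj n r * D)"
    unfolding weyl_inv_def using c EA by (subst mult_blk[where n = n]) (auto simp: sm)
  moreover have "weyl_inv X n r * ?g \<in> G_set X n" using weyl_inv_G_set g by (rule G_set_mult)
  ultimately show "weyl_inv X n r * ?g \<in> P_set X n"
    using c by (auto intro!: P_setI simp: sm)
  have "weyl X n r * (weyl_inv X n r * ?g) = weyl X n r * weyl_inv X n r * ?g"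
    using gc by (simp add: square_mat_simps[where n = "2 * n"])
  also have "\<dots> = ?g" unfolding weyl_inverse using gc by (rule left_mult_one_mat)
  finally show "?g = weyl X n r * (weyl_inv X n r * ?g)" by (rule sym)
qed

lemma add_eq_zero_mat:
  fixes A B :: "'a::comm_ring_1 mat"
  assumes "A \<in> carrier_mat n n" "B \<in> carrier_mat n n" "A + B = 0\<^sub>m n n"
  shows "B = - 1 \<cdot>\<^sub>m A"
proof (rule eq_matI)
  fix i j assume ij: "i < dim_row (- 1 \<cdot>\<^sub>m A)" "j < dim_col (- 1 \<cdot>\<^sub>m A)"
  have "A $$ (i, j) + B $$ (i, j) = 0\<^sub>m n n $$ (i, j)"
    unfolding assms(3)[symmetric] using ij assms(1,2) by simp
  then show "B $$ (i, j) = (- 1 \<cdot>\<^sub>m A) $$ (i, j)"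
    using ij assms(1,2) by (simp add: add_eq_0_iff)
qed (use assms in auto)

lemma add_neg_mat:
  fixes A :: "'a::comm_ring_1 mat"
  assumes "A \<in> carrier_mat n n"
  shows "A + - 1 \<cdot>\<^sub>m A = 0\<^sub>m n n" "- 1 \<cdot>\<^sub>m A + A = 0\<^sub>m n n"
  using assms by (auto intro!: eq_matI)

text \<open>The Levi subgroup brings the lower left block to the projection \<open>E\<close> of its rank. The first block
  equation of the form then reads \<open>E * A = - eps X \<cdot>\<^sub>m (A\<^sup>T * E)\<close>, so \<open>E * A\<close> has exactly the symmetry of
  the upper right block of a unipotent element, and that element clears it.\<close>

lemma cover_form:
  fixes g :: "'a::field mat"
  assumes X: "form_family X" and g: "g \<in> G_set X n"
  shows "\<exists>r\<le>n. \<exists>p\<in>P_set X n. \<exists>q\<in>P_set X n. g = p * weyl X n r * q"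
proof -
  note sm = square_mat_simps[where n = n] and sm2 = square_mat_simps[where n = "2 * n"]
  obtain A B C D where c: "A \<in> carrier_mat n n" "B \<in> carrier_mat n n" "C \<in> carrier_mat n n"
    "D \<in> carrier_mat n n" and gblk: "g = four_block_mat A B C D"
    using G_set_carrier(1)[OF g] by (rule four_blocksE)
  obtain U V r where U: "U \<in> carrier_mat n n" "det U \<noteq> 0" and V: "V \<in> carrier_mat n n" "det V \<noteq> 0"
    and r: "r \<le> n" and UCV: "U * C * V = proj n r"
    using rank_normal_form[OF c(3)] by blast
  obtain U' where U': "U' \<in> carrier_mat n n" "U' * U = 1\<^sub>m n" using nonzero_det_inverse[OF U] by metis
  obtain V' where V': "V' \<in> carrier_mat n n" "V' * V = 1\<^sub>m n" using nonzero_det_inverse[OF V] by metis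
  let ?E = "proj n r :: 'a mat"
  define p1 where "p1 = four_block_mat U'\<^sup>T (0\<^sub>m n n) (0\<^sub>m n n) U"
  define p2 where "p2 = four_block_mat V (0\<^sub>m n n) (0\<^sub>m n n) V'\<^sup>T"
  have p1: "p1 \<in> P_set X n" unfolding p1_def using levi_in_P_set[OF X] U U' by blast
  have p2: "p2 \<in> P_set X n"
  proof -
    have "V\<^sup>T * V'\<^sup>T = (V' * V)\<^sup>T" using V(1) V'(1) by (simp add: sm)
    then have "V\<^sup>T * V'\<^sup>T = 1\<^sub>m n" by (simp only: V'(2) transpose_one)
    then have "four_block_mat V\<^sup>T\<^sup>T (0\<^sub>m n n) (0\<^sub>m n n) V'\<^sup>T \<in> P_set X n"
      using V(1) V'(1) by (intro levi_in_P_set[OF X]) auto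
    then show ?thesis by (simp add: p2_def)
  qed
  define A1 B1 D1 where "A1 = U'\<^sup>T * A * V" and "B1 = U'\<^sup>T * B * V'\<^sup>T" and "D1 = U * D * V'\<^sup>T"
  have c1: "A1 \<in> carrier_mat n n" "B1 \<in> carrier_mat n n" "D1 \<in> carrier_mat n n"
    using c U V U' V' by (simp_all add: A1_def B1_def D1_def sm)
  have g1: "p1 * g * p2 = four_block_mat A1 B1 ?E D1"
  proof -
    have "p1 * g = four_block_mat (U'\<^sup>T * A) (U'\<^sup>T * B) (U * C) (U * D)"
      unfolding p1_def gblk using c U U' by (subst mult_blk[where n = n]) (auto simp: sm)
    moreover have "four_block_mat (U'\<^sup>T * A) (U'\<^sup>T * B) (U * C) (U * D) * p2
        = four_block_mat A1 B1 (U * C * V) D1"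
      unfolding p2_def A1_def B1_def D1_def using c U U' V V' by (subst mult_blk[where n = n]) (auto simp: sm)
    ultimately show ?thesis by (simp only: UCV)
  qed
  have g1G: "four_block_mat A1 B1 ?E D1 \<in> G_set X n"
    unfolding g1[symmetric] using P_set_G_set[OF p1] P_set_G_set[OF p2] g by (intro G_set_mult)
  then obtain l where "(four_block_mat A1 B1 ?E D1)\<^sup>T * J_mat X n * four_block_mat A1 B1 ?E D1 = l \<cdot>\<^sub>m J_mat X n"
    unfolding G_set_form_iff[OF X] by blast
  then have "eps X \<cdot>\<^sub>m (A1\<^sup>T * ?E) + ?E\<^sup>T * A1 = 0\<^sub>m n n"
    using c1 by (subst (asm) form_blk_iff) auto
  then have "?E * A1 = - 1 \<cdot>\<^sub>m (eps X \<cdot>\<^sub>m (A1\<^sup>T * ?E))"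
    using c1 by (intro add_eq_zero_mat[of _ n]) (auto simp: sm)
  then have EA: "?E * A1 = (- eps X) \<cdot>\<^sub>m (A1\<^sup>T * ?E)" by (simp add: smult_smult_mat)
  have EAE: "?E * A1 * ?E = ?E * A1" unfolding EA using c1 by (simp add: sm)
  \<comment> \<open>Adding \<open>Y * E\<close> to \<open>A1\<close> cancels \<open>E * A1\<close>, because \<open>E * A1 * E = E * A1\<close>.\<close>
  define Y where "Y = - 1 \<cdot>\<^sub>m (?E * A1)"
  have Y: "Y \<in> carrier_mat n n" using c1 by (simp add: Y_def sm)
  define p3 where "p3 = four_block_mat (1\<^sub>m n) Y (0\<^sub>m n n) (1\<^sub>m n)"
  have p3: "p3 \<in> P_set X n"
    unfolding p3_def
  proof (rule unipotent_in_P_set[OF Y])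
    have "eps X \<cdot>\<^sub>m Y\<^sup>T = (- eps X) \<cdot>\<^sub>m (A1\<^sup>T * ?E)"
      using c1 by (simp add: Y_def transpose_smult smult_smult_mat sm)
    also have "\<dots> = ?E * A1" by (rule EA[symmetric])
    finally show "eps X \<cdot>\<^sub>m Y\<^sup>T + Y = 0\<^sub>m n n"
      using c1 add_neg_mat[of "?E * A1" n] by (simp add: Y_def sm)
  qed
  have g2: "p3 * four_block_mat A1 B1 ?E D1 = four_block_mat (A1 + Y * ?E) (B1 + Y * D1) ?E D1"
    unfolding p3_def using c1 Y by (subst mult_blk[where n = n]) (auto simp: sm)
  have "Y * ?E = Y" unfolding Y_def using c1 EAE by (simp add: sm)
  then have "?E * (A1 + Y * ?E) = ?E * A1 + - 1 \<cdot>\<^sub>m (?E * A1)"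
    using c1 Y by (simp add: sm Y_def)
  also have "\<dots> = 0\<^sub>m n n" using c1 by (intro add_neg_mat) (simp add: sm)
  finally have "\<exists>q\<in>P_set X n. four_block_mat (A1 + Y * ?E) (B1 + Y * D1) ?E D1 = weyl X n r * q"
    using c1 Y G_set_mult[OF P_set_G_set[OF p3] g1G]
    by (intro double_coset_if_reduced) (auto simp: g2 sm)
  then obtain q where q: "q \<in> P_set X n" "p3 * four_block_mat A1 B1 ?E D1 = weyl X n r * q"
    unfolding g2 by blast
  have "(p3 * p1) * g * p2 = p3 * (p1 * g * p2)"
    using P_set_carrier[OF p1] P_set_carrier[OF p2] P_set_carrier[OF p3] G_set_carrier(1)[OF g]
    by (simp add: sm2)
  then have "(p3 * p1) * g * p2 = weyl X n r * q" unfolding g1 q(2) .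
  then show ?thesis
    using double_coset_repI[OF P_set_mult[OF p3 p1] p2 q(1) G_set_carrier(1)[OF g]] r by blast
qed

lemma upper_blk_in_P_set_GL:
  fixes A D :: "'a::field mat"
  assumes "A \<in> carrier_mat n n" "B \<in> carrier_mat n n" "D \<in> carrier_mat n n" "det A \<noteq> 0" "det D \<noteq> 0"
  shows "four_block_mat A B (0\<^sub>m n n) D \<in> P_set GL n"
  using assms by (intro P_setI) (auto simp: GL_set_iff blk_carrier det_upper_blk[of _ n])

text \<open>Here \<open>E * A\<close> has no symmetry, but the two Levi blocks are independent. With \<open>F\<close> the complementary
  projection, \<open>A * F\<close> has rank at most \<open>n - r\<close>, so a row transformation moves its image into the last
  \<open>n - r\<close> coordinates; this gives \<open>E * A * F = 0\<close>, and a unipotent element clears the rest of \<open>E * A\<close>.\<close>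

lemma cover_GL:
  fixes g :: "'a::field mat"
  assumes g: "g \<in> G_set GL n"
  shows "\<exists>r\<le>n. \<exists>p\<in>P_set GL n. \<exists>q\<in>P_set GL n. g = p * weyl GL n r * q"
proof -
  note sm = square_mat_simps[where n = n] and sm2 = square_mat_simps[where n = "2 * n"]
  obtain A B C D where c: "A \<in> carrier_mat n n" "B \<in> carrier_mat n n" "C \<in> carrier_mat n n"
    "D \<in> carrier_mat n n" and gblk: "g = four_block_mat A B C D"
    using G_set_carrier(1)[OF g] by (rule four_blocksE)
  obtain U V r where U: "U \<in> carrier_mat n n" "det U \<noteq> 0" and V: "V \<in> carrier_mat n n" "det V \<noteq> 0"
    and r: "r \<le> n" and UCV: "U * C * V = proj n r"
    using rank_normal_form[OF c(3)] by blast
  let ?E = "proj n r :: 'a mat" and ?F = "coproj n r :: 'a mat"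
  define A1 where "A1 = A * V"
  have A1: "A1 \<in> carrier_mat n n" using c V by (simp add: A1_def sm)
  obtain S T k where S: "S \<in> carrier_mat n n" "det S \<noteq> 0" and T: "T \<in> carrier_mat n n" "det T \<noteq> 0"
    and k: "k \<le> n" and SAT: "S * (A1 * ?F) * T = proj n k"
    using rank_normal_form[OF square_mat_simps(1)[OF A1 proj_simps(2)]] by blast
  \<comment> \<open>The matrix that reverses the coordinates; it turns the first \<open>k\<close> coordinates into the last \<open>k\<close>.\<close>
  define W where "W = mat n n (\<lambda>(i, j). if i + j = n - 1 then 1 else 0 :: 'a)"
  have W: "W \<in> carrier_mat n n" by (simp add: W_def)
  have WW: "W * W = 1\<^sub>m n"
  proof (rule eq_matI)
    fix i j assume "i < dim_row (1\<^sub>m n :: 'a mat)" "j < dim_col (1\<^sub>m n :: 'a mat)"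
    then have ij: "i < n" "j < n" by simp_all
    have "(W * W) $$ (i, j) = (\<Sum>l = 0..<n. (if i + l = n - 1 then 1 else 0) * (if l + j = n - 1 then 1 else 0))"
      using ij by (simp add: W_def scalar_prod_def)
    also have "\<dots> = (\<Sum>l = 0..<n. if l = n - 1 - i then (if l + j = n - 1 then 1 else 0) else 0)"
      using ij by (intro sum.cong) auto
    also have "\<dots> = (if i = j then 1 else 0)" using ij by (auto simp: sum.delta)
    finally show "(W * W) $$ (i, j) = 1\<^sub>m n $$ (i, j)" using ij by simp
  qed (auto simp: W_def)
  have dW: "det W \<noteq> 0" using inverse_nonzero_det(1)[OF W W WW] .
  have WFW: "W * ?F = proj n (n - r) * W"
    unfolding proj_def coproj_def using W
    by (auto simp: mat_diag_mult_left[of _ n n] mat_diag_mult_right[of _ n n] W_def intro!: eq_matI)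
  have WEW: "?E * (W * proj n k) = 0\<^sub>m n n" if "k \<le> n - r"
    unfolding proj_def using W that r
    by (auto simp: mat_diag_mult_left[of _ n n] mat_diag_mult_right[of _ n n] W_def intro!: eq_matI)
  have "k \<le> n - r"
  proof (rule rank_le_if_factor[OF _ _ k])
    have "proj n k = S * (A1 * ((W * W) * ?F)) * T" unfolding WW SAT[symmetric] by (simp add: sm)
    also have "\<dots> = (S * A1 * W) * proj n (n - r) * (W * T)"
    proof -
      have "W * W * ?F = W * (W * ?F)" using W by (simp add: sm)
      then show ?thesis unfolding WFW using S T A1 W by (simp add: sm)
    qed
    finally show "proj n k = (S * A1 * W) * proj n (n - r) * (W * T)" .
  qed (use S T A1 W in \<open>simp_all add: sm\<close>)
  define L where "L = W * S"
  have L: "L \<in> carrier_mat n n" "det L \<noteq> 0"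
    using W S dW by (simp_all add: L_def sm det_mult[of _ n])
  obtain T' where T': "T' \<in> carrier_mat n n" "T * T' = 1\<^sub>m n" using nonzero_det_inverse[OF T] by metis
  define A2 where "A2 = L * A1"
  have A2: "A2 \<in> carrier_mat n n" using L A1 by (simp add: A2_def sm)
  have "?E * A2 * ?F = ?E * (W * (S * (A1 * ?F) * (T * T')))"
    unfolding T'(2) using W S A1 by (simp add: A2_def L_def sm)
  also have "\<dots> = ?E * (W * (S * (A1 * ?F) * T)) * T'"
    using W S A1 T T'(1) by (simp add: sm)
  also have "\<dots> = ?E * (W * proj n k) * T'" unfolding SAT ..
  also have "\<dots> = 0\<^sub>m n n" unfolding WEW[OF \<open>k \<le> n - r\<close>] using T' by simp
  finally have EAF: "?E * A2 * ?F = 0\<^sub>m n n" .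
  have EAE: "?E * A2 * ?E = ?E * A2"
  proof -
    have "?E * A2 = ?E * A2 * (?E + ?F)" using A2 by (simp add: sm)
    also have "\<dots> = ?E * A2 * ?E + ?E * A2 * ?F" using A2 by (intro square_mat_simps(6)[where n = n]) (auto simp: sm)
    finally show ?thesis unfolding EAF using A2 by (simp add: sm)
  qed
  define Y where "Y = - 1 \<cdot>\<^sub>m (?E * A2)"
  have Y: "Y \<in> carrier_mat n n" using A2 by (simp add: Y_def sm)
  define p where "p = four_block_mat L (Y * U) (0\<^sub>m n n) U"
  define q where "q = four_block_mat V (0\<^sub>m n n) (0\<^sub>m n n) (1\<^sub>m n)"
  have p: "p \<in> P_set GL n" and q: "q \<in> P_set GL n"
    unfolding p_def q_def using L U V Y by (auto intro!: upper_blk_in_P_set_GL simp: sm)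
  have pg: "p * g = four_block_mat (L * A + Y * U * C) (L * B + Y * U * D) (U * C) (U * D)"
    unfolding p_def gblk using L Y U c by (subst mult_blk[where n = n]) (auto simp: sm)
  have pgq: "p * g * q = four_block_mat (A2 + Y * ?E) (L * B + Y * U * D) ?E (U * D)"
  proof -
    have "Y * ?E = Y * U * C * V" unfolding UCV[symmetric] using Y U V c by (simp add: sm)
    then show ?thesis
      unfolding pg q_def using L Y U V c UCV
      by (subst mult_blk[where n = n]) (auto simp: sm A2_def A1_def)
  qed
  have "Y * ?E = Y" unfolding Y_def using A2 EAE by (simp add: sm)
  then have "?E * (A2 + Y * ?E) = ?E * A2 + - 1 \<cdot>\<^sub>m (?E * A2)"
    using A2 Y by (simp add: sm Y_def)
  also have "\<dots> = 0\<^sub>m n n" using A2 by (intro add_neg_mat) (simp add: sm)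
  finally have red: "?E * (A2 + Y * ?E) = 0\<^sub>m n n" .
  have "p * g * q \<in> G_set GL n"
    using P_set_G_set[OF p] P_set_G_set[OF q] g by (intro G_set_mult)
  then have "\<exists>q'\<in>P_set GL n. p * g * q = weyl GL n r * q'"
    unfolding pgq using red A2 Y L U c by (intro double_coset_if_reduced) (auto simp: sm)
  then obtain q' where "q' \<in> P_set GL n" "p * g * q = weyl GL n r * q'" by blast
  then show ?thesis using double_coset_repI[OF p q _ G_set_carrier(1)[OF g]] r by blast
qed

section \<open>The diagonal torus\<close>

definition torus :: "nat \<Rightarrow> (nat \<Rightarrow> 'a) \<Rightarrow> (nat \<Rightarrow> 'a) \<Rightarrow> 'a::field mat" where
  "torus n a d = four_block_mat (mat_diag n a) (0\<^sub>m n n) (0\<^sub>m n n) (mat_diag n d)"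

lemma det_torus: "det (torus n a d) = (\<Prod>i<n. a i) * (\<Prod>i<n. d i)"
  by (simp add: torus_def det_upper_blk[of _ n] det_mat_diag)

text \<open>Conjugation by the representative of rank \<open>r\<close> exchanges the first \<open>r\<close> entries of the two halves of
  the torus.\<close>

lemma torus_weyl:
  "torus n a d * weyl X n r
    = weyl X n r * torus n (\<lambda>i. if i < r then d i else a i) (\<lambda>i. if i < r then a i else d i)"
proof -
  let ?a = "\<lambda>i. if i < r then d i else a i" and ?d = "\<lambda>i. if i < r then a i else d i"
  have "mat_diag n a * coproj n r = coproj n r * mat_diag n ?a"
    "mat_diag n d * proj n r = proj n r * mat_diag n ?a"
    "mat_diag n a * proj n r = proj n r * mat_diag n ?d"
    "mat_diag n d * coproj n r = coproj n r * mat_diag n ?d"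
    unfolding proj_def coproj_def by (auto intro!: mat_diag_cong)
  then show ?thesis
    unfolding torus_def weyl_def
    by (simp add: mult_blk[where n = n] square_mat_simps[where n = n])
qed

lemma torus_in_P_set_form:
  assumes X: "form_family X" and l: "factor_ok X l" and ad: "\<And>i. i < n \<Longrightarrow> d i * a i = l"
  shows "torus n a d \<in> P_set X n"
  unfolding torus_def
proof (rule upper_blk_in_P_set[OF X _ _ _ _ _ l])
  have "a i \<noteq> 0 \<and> d i \<noteq> 0" if "i < n" for i using ad[OF that] l by (auto simp: factor_ok_def)
  then show "det (mat_diag n a) \<noteq> 0" "det (mat_diag n d) \<noteq> 0" by (auto simp: det_mat_diag)
  have "mat_diag n d * mat_diag n a = mat_diag n (\<lambda>i. l * 1)"
    by (auto simp: ad intro!: mat_diag_cong)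
  also have "\<dots> = l \<cdot>\<^sub>m 1\<^sub>m n" unfolding mat_diag_smult[symmetric] mat_diag_one ..
  finally show "(mat_diag n d)\<^sup>T * mat_diag n a = l \<cdot>\<^sub>m 1\<^sub>m n" by simp
qed (auto simp: square_mat_simps[where n = n])

lemma torus_in_P_set_GL:
  assumes "\<And>i. i < n \<Longrightarrow> a i \<noteq> 0" "\<And>i. i < n \<Longrightarrow> d i \<noteq> 0"
  shows "torus n a d \<in> P_set GL n"
  unfolding torus_def using assms by (intro upper_blk_in_P_set_GL) (auto simp: det_mat_diag)

lemma P_set_SL_iff: "p \<in> P_set SL n \<longleftrightarrow> p \<in> P_set GL n \<and> det p = 1"
  by (auto simp: P_set_def)

text \<open>In a factorization within the general linear group, a torus element moved across the representative
  keeps its determinant, so both outer factors can be given determinant one.\<close>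

lemma cover_SL:
  fixes g :: "'a::field mat"
  assumes "n \<ge> 1" and g: "g \<in> G_set SL n"
  shows "\<exists>r\<le>n. \<exists>p\<in>P_set SL n. \<exists>q\<in>P_set SL n. g = p * weyl SL n r * q"
proof -
  note sm2 = square_mat_simps[where n = "2 * n"]
  have "g \<in> G_set GL n" "det g = 1" using g by auto
  then obtain r p q where r: "r \<le> n" and p: "p \<in> P_set GL n" and q: "q \<in> P_set GL n"
    and eq: "g = p * weyl GL n r * q" using cover_GL by blast
  have w: "weyl GL n r = (weyl SL n r :: 'a mat)" by (simp add: weyl_def eps_def)
  define x where "x = det p"
  have x: "x \<noteq> 0" using G_set_carrier(2)[OF P_set_G_set[OF p]] by (simp add: x_def)
  \<comment> \<open>A torus element of determinant \<open>1 / det p\<close>.\<close>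
  define t where "t i = (if i = 0 then inverse x else 1)" for i :: nat
  have t: "t i \<noteq> 0" for i using x by (simp add: t_def)
  have prod_t: "(\<Prod>i<n. t i) = inverse x" using assms(1) by (simp add: t_def prod.delta)
  let ?s = "torus n (\<lambda>i. if i < r then t i else 1) (\<lambda>i. if i < r then 1 else t i)"
  let ?s' = "torus n (\<lambda>_. 1) t"
  have s'P: "?s' \<in> P_set GL n" by (rule torus_in_P_set_GL) (simp_all add: t)
  have sP: "?s \<in> P_set GL n" by (rule torus_in_P_set_GL) (simp_all add: t)
  obtain h where h: "h \<in> P_set GL n" "?s * h = 1\<^sub>m (2 * n)" using P_set_inverse[OF sP] by metis
  note c = P_set_carrier[OF s'P] P_set_carrier[OF sP] P_set_carrier[OF p] P_set_carrier[OF q] P_set_carrier[OF h(1)]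
  have sw: "?s' * weyl SL n r = weyl SL n r * ?s" by (rule torus_weyl)
  have "(p * ?s') * weyl SL n r * (h * q) = p * (?s' * weyl SL n r) * (h * q)"
    using c by (simp add: sm2)
  also have "\<dots> = p * weyl SL n r * (?s * h) * q"
    unfolding sw using c by (simp add: sm2)
  also have "\<dots> = g" unfolding h(2) eq w using c by (simp add: sm2)
  finally have geq: "g = (p * ?s') * weyl SL n r * (h * q)" by (rule sym)
  have dps: "det (p * ?s') = 1"
    using det_mult[OF c(3) c(1)] x by (simp add: det_torus prod_t x_def[symmetric])
  have dw: "det (weyl SL n r :: 'a mat) = 1" by (rule det_weyl) (simp add: eps_def)
  have "det g = det (p * ?s' * weyl SL n r) * det (h * q)"
    unfolding geq using c by (intro det_mult) (auto simp: sm2)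
  also have "det (p * ?s' * weyl SL n r) = 1"
    using det_mult[of "p * ?s'" "2 * n" "weyl SL n r"] c dps dw by (simp add: sm2)
  finally have dhq: "det (h * q) = 1" using \<open>det g = 1\<close> by simp
  have "p * ?s' \<in> P_set SL n"
    unfolding P_set_SL_iff using P_set_mult[OF p s'P] dps by (rule conjI)
  moreover have "h * q \<in> P_set SL n"
    unfolding P_set_SL_iff using P_set_mult[OF h(1) q] dhq by (rule conjI)
  ultimately show ?thesis using geq r by blast
qed

section \<open>Double cosets and their stabilizers\<close>

theorem double_cosets_cover:
  fixes g :: "'a::field mat"
  assumes "n \<ge> 1" and "g \<in> G_set X n"
  shows "\<exists>r\<le>n. \<exists>p\<in>P_set X n. \<exists>q\<in>P_set X n. g = p * weyl X n r * q"
  using assms cover_GL cover_SL cover_form by (cases X rule: family_cases) blast+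

lemma conjugation_blocks:
  fixes A B D A' B' D' :: "'a::field mat"
  assumes c: "A \<in> carrier_mat n n" "B \<in> carrier_mat n n" "D \<in> carrier_mat n n"
    "A' \<in> carrier_mat n n" "B' \<in> carrier_mat n n" "D' \<in> carrier_mat n n"
    and eq: "four_block_mat A B (0\<^sub>m n n) D * weyl X n r = weyl X n r * four_block_mat A' B' (0\<^sub>m n n) D'"
  shows "eps X \<cdot>\<^sub>m (A * proj n r) + B * coproj n r = coproj n r * B' + eps X \<cdot>\<^sub>m (proj n r * D')"
    and "D * proj n r = proj n r * A'"
    and "D * coproj n r = proj n r * B' + coproj n r * D'"
proof -
  note sm = square_mat_simps[where n = n]
  have "four_block_mat A B (0\<^sub>m n n) D * weyl X n r
      = four_block_mat (A * coproj n r + B * proj n r) (eps X \<cdot>\<^sub>m (A * proj n r) + B * coproj n r)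
        (D * proj n r) (D * coproj n r)"
    unfolding weyl_def using c by (subst mult_blk[where n = n]) (auto simp: sm)
  moreover have "weyl X n r * four_block_mat A' B' (0\<^sub>m n n) D'
      = four_block_mat (coproj n r * A') (coproj n r * B' + eps X \<cdot>\<^sub>m (proj n r * D'))
        (proj n r * A') (proj n r * B' + coproj n r * D')"
    unfolding weyl_def using c by (subst mult_blk[where n = n]) (auto simp: sm)
  ultimately have "four_block_mat (A * coproj n r + B * proj n r) (eps X \<cdot>\<^sub>m (A * proj n r) + B * coproj n r)
        (D * proj n r) (D * coproj n r)
      = four_block_mat (coproj n r * A') (coproj n r * B' + eps X \<cdot>\<^sub>m (proj n r * D'))
        (proj n r * A') (proj n r * B' + coproj n r * D')"
    using eq by simp
  then show "eps X \<cdot>\<^sub>m (A * proj n r) + B * coproj n r = coproj n r * B' + eps X \<cdot>\<^sub>m (proj n r * D')"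
    and "D * proj n r = proj n r * A'"
    and "D * coproj n r = proj n r * B' + coproj n r * D'"
    using c by (subst (asm) blk_eq_iff[of _ n]; simp add: sm)+
qed

lemma rank_le_if_same_double_coset:
  fixes p q :: "'a::field mat"
  assumes p: "p \<in> P_set X n" and q: "q \<in> P_set X n" and j: "j \<le> n"
    and eq: "weyl X n j = p * weyl X n i * q"
  shows "j \<le> i"
proof -
  note sm = square_mat_simps[where n = n]
  obtain A B D where p': "A \<in> carrier_mat n n" "B \<in> carrier_mat n n" "D \<in> carrier_mat n n"
    "p = four_block_mat A B (0\<^sub>m n n) D" "det p = det A * det D" "det A \<noteq> 0" "det D \<noteq> 0"
    using p by (rule P_setE)
  obtain A' B' D' where q': "A' \<in> carrier_mat n n" "B' \<in> carrier_mat n n" "D' \<in> carrier_mat n n"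
    "q = four_block_mat A' B' (0\<^sub>m n n) D'" "det q = det A' * det D'" "det A' \<noteq> 0" "det D' \<noteq> 0"
    using q by (rule P_setE)
  let ?M = "A * coproj n i + B * proj n i" and ?N = "eps X \<cdot>\<^sub>m (A * proj n i) + B * coproj n i"
  have "p * weyl X n i = four_block_mat ?M ?N (D * proj n i) (D * coproj n i)"
    unfolding weyl_def p'(4) using p' by (subst mult_blk[where n = n]) (auto simp: sm)
  then have "p * weyl X n i * q = four_block_mat (?M * A') (?M * B' + ?N * D') (D * proj n i * A')
      (D * proj n i * B' + D * coproj n i * D')"
    unfolding q'(4) using p' q' by (simp, subst mult_blk[where n = n]) (auto simp: sm)
  then have "four_block_mat (coproj n j) (eps X \<cdot>\<^sub>m proj n j) (proj n j) (coproj n j) = four_block_mat (?M * A')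
      (?M * B' + ?N * D') (D * proj n i * A') (D * proj n i * B' + D * coproj n i * D')"
    using eq by (simp add: weyl_def[of X n j])
  then have "proj n j = D * proj n i * A'"
    using p' q' by (subst (asm) blk_eq_iff[of _ n]) (simp_all add: sm)
  then show ?thesis using rank_le_if_factor[OF p'(3) q'(1) j] by blast
qed

text \<open>The rank of the lower left block is constant on double cosets.\<close>

theorem double_cosets_disjoint:
  fixes p q :: "'a::field mat"
  assumes p: "p \<in> P_set X n" and q: "q \<in> P_set X n" and ij: "i \<le> n" "j \<le> n"
    and eq: "weyl X n j = p * weyl X n i * q"
  shows "i = j"
proof (rule antisym)
  show "j \<le> i" by (rule rank_le_if_same_double_coset[OF p q ij(2) eq])
  note sm2 = square_mat_simps[where n = "2 * n"]
  obtain p' where p': "p' \<in> P_set X n" "p' * p = 1\<^sub>m (2 * n)" using P_set_inverse[OF p] by metis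
  obtain q' where q': "q' \<in> P_set X n" "q * q' = 1\<^sub>m (2 * n)" using P_set_inverse[OF q] by metis
  note c = P_set_carrier[OF p] P_set_carrier[OF q] P_set_carrier[OF p'(1)] P_set_carrier[OF q'(1)]
  have "p' * weyl X n j * q' = (p' * p) * weyl X n i * (q * q')"
    unfolding eq using c by (simp add: sm2)
  also have "\<dots> = weyl X n i" unfolding p' q' by (simp add: sm2)
  finally show "i \<le> j" using rank_le_if_same_double_coset[OF p'(1) q'(1) ij(1), of j] by simp
qed

lemma det_scaled_proj:
  assumes "r \<le> n"
  shows "det (l \<cdot>\<^sub>m proj n r + coproj n r) = (l ^ r :: 'a::field)"
proof -
  have "l \<cdot>\<^sub>m proj n r + coproj n r = mat_diag n (\<lambda>i. if i < r then l else 1)"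
    unfolding proj_def coproj_def mat_diag_smult mat_diag_add by (intro mat_diag_cong) auto
  then have "det (l \<cdot>\<^sub>m proj n r + coproj n r) = (\<Prod>i<n. if i < r then l else 1)"
    by (simp only: det_mat_diag)
  also have "\<dots> = (\<Prod>i<r. l)"
    using assms by (intro prod.mono_neutral_cong_right) auto
  finally show ?thesis by simp
qed

text \<open>If \<open>p * w = w * q\<close>, then \<open>D\<close> and \<open>D'\<close> are block triangular and share the block on the last \<open>n - r\<close>
  coordinates, of determinant \<open>e\<close>. On the first \<open>r\<close> coordinates \<open>D\<close> keeps its own block, of determinant
  \<open>d\<close>, and \<open>D'\<close> receives the block of \<open>A\<close>, of determinant \<open>a\<close>. The relation \<open>D\<^sup>T * A = l \<cdot>\<^sub>m 1\<^sub>m n\<close>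
  restricted to these coordinates is \<open>a * d = l ^ r\<close>.\<close>

lemma det_conjugate:
  fixes A B D A' B' D' :: "'a::field mat"
  assumes c: "A \<in> carrier_mat n n" "B \<in> carrier_mat n n" "D \<in> carrier_mat n n"
    "A' \<in> carrier_mat n n" "B' \<in> carrier_mat n n" "D' \<in> carrier_mat n n"
    and eq: "four_block_mat A B (0\<^sub>m n n) D * weyl X n r = weyl X n r * four_block_mat A' B' (0\<^sub>m n n) D'"
    and l: "D\<^sup>T * A = l \<cdot>\<^sub>m 1\<^sub>m n" and r: "r \<le> n"
  obtains a d e where "det D = d * e" "det D' = a * e" "a * d = l ^ r"
proof -
  note sm = square_mat_simps[where n = n]
  define E F where "E = (proj n r :: 'a mat)" and "F = (coproj n r :: 'a mat)"
  have cEF: "E \<in> carrier_mat n n" "F \<in> carrier_mat n n" by (simp_all add: E_def F_def)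
  have EF: "E * E = E" "E * F = 0\<^sub>m n n" "F * E = 0\<^sub>m n n" "F * F = F" "E + F = 1\<^sub>m n" "F + E = 1\<^sub>m n"
    "E\<^sup>T = E" "F\<^sup>T = F"
    by (simp_all add: E_def F_def)
  have absorb: "E * (E * X) = E * X" "F * (F * X) = F * X" "E * (F * X) = 0\<^sub>m n n" "F * (E * X) = 0\<^sub>m n n"
    if "X \<in> carrier_mat n n" for X
    using that by (simp_all add: E_def F_def)
  note blocks = conjugation_blocks[OF c eq, folded E_def F_def]
  have FDE: "F * D * E = 0\<^sub>m n n"
    using c cEF absorb by (simp add: sm blocks(2))
  have FDF: "F * D * F = F * D'"
    using c cEF absorb by (simp add: sm blocks(3))
  have FDE': "F * D' * E = 0\<^sub>m n n"
    unfolding FDF[symmetric] using c cEF EF by (simp add: sm)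
  have FDF': "F * D' * F = F * D * F"
    unfolding FDF[symmetric] using c cEF EF by (simp add: sm)
  have EAE: "E * A * E = E * D' * E"
  proof -
    have "eps X \<cdot>\<^sub>m (E * A * E) = E * (eps X \<cdot>\<^sub>m (A * E) + B * F) * E"
      using c cEF EF by (simp add: sm)
    also have "\<dots> = eps X \<cdot>\<^sub>m (E * D' * E)"
      unfolding blocks(1) using c cEF EF absorb by (simp add: sm)
    finally have "eps X \<cdot>\<^sub>m (eps X \<cdot>\<^sub>m (E * A * E)) = eps X \<cdot>\<^sub>m (eps X \<cdot>\<^sub>m (E * D' * E))" by simp
    then show ?thesis by (simp add: smult_smult_mat)
  qed
  have EDF: "E * D\<^sup>T * F = 0\<^sub>m n n"
  proof -
    have "E * D\<^sup>T * F = (F * D * E)\<^sup>T" using c cEF EF by (simp add: sm)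
    then show ?thesis unfolding FDE by simp
  qed
  have EDE: "E * D\<^sup>T * E = E * D\<^sup>T"
  proof -
    have "E * D\<^sup>T = E * D\<^sup>T * (E + F)" using c cEF EF by (simp add: sm)
    also have "\<dots> = E * D\<^sup>T * E + E * D\<^sup>T * F" using c cEF by (intro square_mat_simps(6)[where n = n]) (auto simp: sm)
    also have "\<dots> = E * D\<^sup>T * E" unfolding EDF using c cEF by (intro right_add_zero_mat[of _ n n]) (simp add: sm)
    finally show ?thesis by (rule sym)
  qed
  have ct: "E * D * E + F \<in> carrier_mat n n" "E * A * E + F \<in> carrier_mat n n"
    using c cEF by (simp_all add: sm)
  have "(E * D * E + F)\<^sup>T * (E * A * E + F) = (E * D\<^sup>T * E) * A * E + F"
    using c cEF EF absorb by (simp add: sm)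
  also have "(E * D\<^sup>T * E) * A * E = E * (D\<^sup>T * A) * E" unfolding EDE using c cEF by (simp add: sm)
  also have "\<dots> = l \<cdot>\<^sub>m E" unfolding l using cEF EF by (simp add: sm)
  finally have "det ((E * D * E + F)\<^sup>T * (E * A * E + F)) = l ^ r"
    using det_scaled_proj[OF r, of l] by (simp add: E_def F_def)
  then have "det (E * A * E + F) * det (E * D * E + F) = l ^ r"
    using ct by (simp add: det_mult[of _ n] det_transpose[of _ n] mult.commute)
  moreover have "det D = det (E * D * E + F) * det (F * D * F + E)"
    using det_block_triangular[OF c(3), of r] FDE by (simp add: E_def F_def)
  moreover have "det D' = det (E * A * E + F) * det (F * D * F + E)"
    using det_block_triangular[OF c(6), of r] FDE' EAE FDF' by (simp add: E_def F_def)
  ultimately show thesis using that by blast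
qed

section \<open>Admissible double cosets\<close>

lemma chi_det_blk:
  assumes "A \<in> carrier_mat n n" "B \<in> carrier_mat n n" "D \<in> carrier_mat n n"
  shows "chi_det n (four_block_mat A B (0\<^sub>m n n) D) = inverse (det D)"
  unfolding chi_det_def using assms by (subst split_block_blk[of _ n]) auto

lemma multiplier_form:
  assumes X: "form_family X" and "n \<ge> 1" and p: "p \<in> P_set X n"
    and l: "factor_ok X l" "p\<^sup>T * J_mat X n * p = l \<cdot>\<^sub>m J_mat X n"
  shows "multiplier X n p = l"
proof -
  obtain A B D where p': "A \<in> carrier_mat n n" "B \<in> carrier_mat n n" "D \<in> carrier_mat n n"
    "p = four_block_mat A B (0\<^sub>m n n) D" "det p = det A * det D" "det A \<noteq> 0" "det D \<noteq> 0"
    using p by (rule P_setE)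
  have "D\<^sup>T * A = l \<cdot>\<^sub>m 1\<^sub>m n" using l(2) p' form_upper_iff[OF p'(1-3)] by blast
  then have "similitude n p = l"
    unfolding p'(4) using similitude_eq[OF assms(2) p'(1-3)] l(1) by (simp add: factor_ok_def)
  then show ?thesis using X l(1) by (cases X) (auto simp: form_family_def factor_ok_def)
qed

lemma multiplier_GL:
  assumes "p \<in> P_set GL n"
  shows "multiplier GL n p = det p"
proof -
  obtain A B D where p': "A \<in> carrier_mat n n" "B \<in> carrier_mat n n" "D \<in> carrier_mat n n"
    "p = four_block_mat A B (0\<^sub>m n n) D" "det p = det A * det D" "det A \<noteq> 0" "det D \<noteq> 0"
    using assms by (rule P_setE)
  then show ?thesis by (simp add: split_block_blk[of _ n] det_mult[of _ n])
qed

text \<open>The multiplier is the determinant, the scalar by which the form is scaled, or trivial; each of these is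
  invariant under conjugation in the whole group and not only in the parabolic.\<close>

lemma multiplier_conjugate:
  fixes p q :: "'a::field mat"
  assumes "n \<ge> 1" and p: "p \<in> P_set X n" and q: "q \<in> P_set X n" and eq: "p * weyl X n r = weyl X n r * q"
  shows "multiplier X n p = multiplier X n q"
proof -
  note sm2 = square_mat_simps[where n = "2 * n"]
  let ?w = "weyl X n r :: 'a mat"
  note c = P_set_carrier[OF p] P_set_carrier[OF q]
  show ?thesis
  proof (cases X rule: family_cases)
    case 1
    have "det p * det ?w = det ?w * det q"
      by (metis eq c det_mult weyl_carrier(1))
    moreover have "det ?w \<noteq> 0" using weyl_G_set by (rule G_set_carrier(2))
    ultimately have "det p = det q" by simp
    then show ?thesis using p q unfolding 1 by (simp only: multiplier_GL)
  next
    case 2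
    then show ?thesis by simp
  next
    case 3
    let ?J = "J_mat X n :: 'a mat"
    obtain l where l: "factor_ok X l" "p\<^sup>T * ?J * p = l \<cdot>\<^sub>m ?J"
      using P_set_G_set[OF p] unfolding G_set_form_iff[OF 3] by blast
    obtain m where m: "factor_ok X m" "?w\<^sup>T * ?J * ?w = m \<cdot>\<^sub>m ?J"
      using weyl_G_set[of X n r] unfolding G_set_form_iff[OF 3] by blast
    have "m \<cdot>\<^sub>m (q\<^sup>T * ?J * q) = q\<^sup>T * (?w\<^sup>T * ?J * ?w) * q"
      unfolding m(2) using c by (simp add: sm2)
    also have "\<dots> = (?w * q)\<^sup>T * ?J * (?w * q)" using c by (simp add: sm2)
    also have "\<dots> = ?w\<^sup>T * (p\<^sup>T * ?J * p) * ?w" unfolding eq[symmetric] using c by (simp add: sm2)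
    also have "\<dots> = l \<cdot>\<^sub>m (?w\<^sup>T * ?J * ?w)" unfolding l(2) by (simp add: sm2)
    also have "\<dots> = m \<cdot>\<^sub>m (l \<cdot>\<^sub>m ?J)" unfolding m(2) by (simp add: smult_smult_mat mult.commute)
    finally have "inverse m \<cdot>\<^sub>m (m \<cdot>\<^sub>m (q\<^sup>T * ?J * q)) = inverse m \<cdot>\<^sub>m (m \<cdot>\<^sub>m (l \<cdot>\<^sub>m ?J))" by simp
    then have "q\<^sup>T * ?J * q = l \<cdot>\<^sub>m ?J"
      using m(1) by (simp add: smult_smult_mat factor_ok_def mult.assoc[symmetric])
    then show ?thesis
      using multiplier_form[OF 3 assms(1) p l] multiplier_form[OF 3 assms(1) q l(1)] by simp
  qed
qed

locale siegel_character =
  fixes X :: group_family and n :: nat and \<chi> :: "'a::{field,finite} mat \<Rightarrow> complex" and \<alpha> \<beta> :: "'a \<Rightarrow> complex"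
  assumes n: "n \<ge> 1"
    and chi_hom: "\<chi> \<in> hom (P_grp X n) mult_grp"
    and beta_hom: "\<beta> \<in> hom mult_grp mult_grp"
    and chi_eq: "\<forall>p \<in> P_set X n. \<chi> p = \<alpha> (multiplier X n p) * \<beta> (chi_det n p)"
begin

sublocale induced_character "G_grp X n" "P_set X n" \<chi>
proof (intro induced_character.intro induced_character_axioms.intro group_G_grp)
  show "\<chi> (p \<otimes>\<^bsub>G_grp X n\<^esub> q) = \<chi> p * \<chi> q" if "p \<in> P_set X n" "q \<in> P_set X n" for p q
    using chi_hom that by (simp add: hom_def P_grp_def mult_grp_def)
  show "\<chi> p \<noteq> 0" if "p \<in> P_set X n" for p
    using chi_hom that by (auto simp: hom_def P_grp_def mult_grp_def)
qed (simp_all add: finite_G_set subgroup_P_set)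

lemma beta_mult: "x \<noteq> 0 \<Longrightarrow> y \<noteq> 0 \<Longrightarrow> \<beta> (x * y) = \<beta> x * \<beta> y"
  using beta_hom by (simp add: hom_def mult_grp_def)

lemma beta_nonzero: "x \<noteq> 0 \<Longrightarrow> \<beta> x \<noteq> 0"
  using beta_hom by (auto simp: hom_def mult_grp_def)

lemma beta_one: "\<beta> 1 = 1"
  using beta_mult[of 1 1] beta_nonzero[of 1] by simp

lemma beta_inverse: "x \<noteq> 0 \<Longrightarrow> \<beta> (inverse x) = inverse (\<beta> x)"
  using beta_mult[of x "inverse x"] beta_one inverse_unique[of "\<beta> x" "\<beta> (inverse x)"] by simp

lemma beta_power: "x \<noteq> 0 \<Longrightarrow> \<beta> (x ^ k) = \<beta> x ^ k"
  by (induction k) (simp_all add: beta_one beta_mult)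

text \<open>As the multipliers agree, the part \<open>\<alpha>\<close> of the character cancels and only \<open>\<beta>\<close> can obstruct
  admissibility.\<close>

lemma chi_conjugate_iff:
  fixes A B D A' B' D' :: "'a mat"
  assumes c: "A \<in> carrier_mat n n" "B \<in> carrier_mat n n" "D \<in> carrier_mat n n"
    "A' \<in> carrier_mat n n" "B' \<in> carrier_mat n n" "D' \<in> carrier_mat n n"
    and p: "p \<in> P_set X n" "p = four_block_mat A B (0\<^sub>m n n) D"
    and q: "q \<in> P_set X n" "q = four_block_mat A' B' (0\<^sub>m n n) D'"
    and d: "det D \<noteq> 0" "det D' \<noteq> 0"
    and eq: "p * weyl X n r = weyl X n r * q"
  shows "\<chi> p = \<chi> q \<longleftrightarrow> \<beta> (det D) = \<beta> (det D')"
proof -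
  have m: "multiplier X n p = multiplier X n q" by (rule multiplier_conjugate[OF n p(1) q(1) eq])
  have "\<chi> p \<noteq> 0" using chi_nonzero p(1) by blast
  then have a: "\<alpha> (multiplier X n p) \<noteq> 0" using chi_eq p(1) by auto
  have "\<chi> p = \<chi> q \<longleftrightarrow> \<beta> (inverse (det D)) = \<beta> (inverse (det D'))"
    using chi_eq p q a m chi_det_blk[OF c(1-3)] chi_det_blk[OF c(4-6)] by auto
  then show ?thesis using d by (simp add: beta_inverse)
qed

lemma admissibleI:
  assumes "\<And>A B D A' B' D'. A \<in> carrier_mat n n \<Longrightarrow> B \<in> carrier_mat n n \<Longrightarrow> D \<in> carrier_mat n n \<Longrightarrow>
      A' \<in> carrier_mat n n \<Longrightarrow> B' \<in> carrier_mat n n \<Longrightarrow> D' \<in> carrier_mat n n \<Longrightarrow>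
      four_block_mat A B (0\<^sub>m n n) D \<in> P_set X n \<Longrightarrow> four_block_mat A' B' (0\<^sub>m n n) D' \<in> P_set X n \<Longrightarrow>
      det D \<noteq> 0 \<Longrightarrow> det D' \<noteq> 0 \<Longrightarrow>
      four_block_mat A B (0\<^sub>m n n) D * weyl X n r = weyl X n r * four_block_mat A' B' (0\<^sub>m n n) D' \<Longrightarrow>
      \<beta> (det D) = \<beta> (det D')"
  shows "admissible (weyl X n r)"
  unfolding admissible_def
proof (intro ballI impI)
  fix p q :: "'a mat" assume p: "p \<in> P_set X n" and q: "q \<in> P_set X n"
    and "p \<otimes>\<^bsub>G_grp X n\<^esub> weyl X n r = weyl X n r \<otimes>\<^bsub>G_grp X n\<^esub> q"
  then have eq: "p * weyl X n r = weyl X n r * q" by simp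
  obtain A B D where p': "A \<in> carrier_mat n n" "B \<in> carrier_mat n n" "D \<in> carrier_mat n n"
    "p = four_block_mat A B (0\<^sub>m n n) D" "det p = det A * det D" "det A \<noteq> 0" "det D \<noteq> 0"
    using p by (rule P_setE)
  obtain A' B' D' where q': "A' \<in> carrier_mat n n" "B' \<in> carrier_mat n n" "D' \<in> carrier_mat n n"
    "q = four_block_mat A' B' (0\<^sub>m n n) D'" "det q = det A' * det D'" "det A' \<noteq> 0" "det D' \<noteq> 0"
    using q by (rule P_setE)
  have "\<beta> (det D) = \<beta> (det D')"
    using assms[OF p'(1-3) q'(1-3)] p q p'(4,7) q'(4,7) eq by simp
  then show "\<chi> p = \<chi> q"
    using chi_conjugate_iff[OF p'(1-3) q'(1-3) p p'(4) q q'(4) p'(7) q'(7) eq] by simp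
qed

text \<open>All obstructions are detected on the torus, where conjugation by \<open>weyl X n r\<close> is explicit.\<close>

lemma not_admissibleI:
  fixes a d :: "nat \<Rightarrow> 'a" and r :: nat
  defines "a' \<equiv> \<lambda>i. if i < r then d i else a i" and "d' \<equiv> \<lambda>i. if i < r then a i else d i"
  assumes t: "torus n a d \<in> P_set X n" "torus n a' d' \<in> P_set X n"
    and neq: "\<beta> (\<Prod>i<n. d i) \<noteq> \<beta> (\<Prod>i<n. d' i)"
  shows "\<not> admissible (weyl X n r)"
proof
  assume adm: "admissible (weyl X n r)"
  have eq: "torus n a d * weyl X n r = weyl X n r * torus n a' d'"
    unfolding a'_def d'_def by (rule torus_weyl)
  then have "\<chi> (torus n a d) = \<chi> (torus n a' d')"
    using adm t unfolding admissible_def by simp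
  moreover have "det (torus n a d) \<noteq> 0" "det (torus n a' d') \<noteq> 0"
    using t P_set_G_set G_set_carrier(2) by blast+
  then have nz: "(\<Prod>i<n. d i) \<noteq> 0" "(\<Prod>i<n. d' i) \<noteq> 0" by (auto simp: det_torus)
  ultimately show False
    using neq chi_conjugate_iff[OF _ _ _ _ _ _ t(1) torus_def t(2) torus_def _ _ eq]
    by (simp add: det_mat_diag)
qed

lemma admissible_zero: "admissible (weyl X n 0)"
proof (rule admissibleI)
  fix A B D A' B' D' :: "'a mat"
  assume c: "A \<in> carrier_mat n n" "B \<in> carrier_mat n n" "D \<in> carrier_mat n n"
    "A' \<in> carrier_mat n n" "B' \<in> carrier_mat n n" "D' \<in> carrier_mat n n"
    and eq: "four_block_mat A B (0\<^sub>m n n) D * weyl X n 0 = weyl X n 0 * four_block_mat A' B' (0\<^sub>m n n) D'"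
  have z: "proj n 0 = (0\<^sub>m n n :: 'a mat)" "coproj n 0 = (1\<^sub>m n :: 'a mat)"
    by (simp_all add: proj_def coproj_def mat_diag_zero)
  have "D = D'" using conjugation_blocks(3)[OF c eq] c unfolding z by simp
  then show "\<beta> (det D) = \<beta> (det D')" by simp
qed

lemma admissible_if_trivial:
  assumes "\<forall>x. x \<noteq> 0 \<longrightarrow> \<beta> x = 1"
  shows "admissible (weyl X n r)"
  by (rule admissibleI) (use assms in simp)

text \<open>For \<open>r = n\<close> the representative exchanges \<open>A\<close> and \<open>D\<close>, whose determinants are inverse to each other.\<close>

lemma admissible_SL_top:
  assumes X: "X = SL" and sq: "\<forall>x. x \<noteq> 0 \<longrightarrow> (\<beta> x)\<^sup>2 = 1"
  shows "admissible (weyl X n n)"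
proof (rule admissibleI)
  fix A B D A' B' D' :: "'a mat"
  assume c: "A \<in> carrier_mat n n" "B \<in> carrier_mat n n" "D \<in> carrier_mat n n"
    "A' \<in> carrier_mat n n" "B' \<in> carrier_mat n n" "D' \<in> carrier_mat n n"
    and q: "four_block_mat A' B' (0\<^sub>m n n) D' \<in> P_set X n" and d: "det D \<noteq> 0"
    and eq: "four_block_mat A B (0\<^sub>m n n) D * weyl X n n = weyl X n n * four_block_mat A' B' (0\<^sub>m n n) D'"
  have "proj n n = mat_diag n (\<lambda>_. 1 :: 'a)" unfolding proj_def by (rule mat_diag_cong) simp
  then have z: "proj n n = (1\<^sub>m n :: 'a mat)" by simp
  have "D = A'" using conjugation_blocks(2)[OF c eq] c unfolding z by simp
  moreover have "det (four_block_mat A' B' (0\<^sub>m n n) D') = 1" using P_set_G_set[OF q] X by simp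
  ultimately have "det D * det D' = 1" by (simp add: det_upper_blk[OF c(4-6)])
  then have "det D' = inverse (det D)" by (simp add: inverse_unique)
  then show "\<beta> (det D) = \<beta> (det D')"
    using sq d inverse_unique[of "\<beta> (det D)" "\<beta> (det D)"] by (simp add: beta_inverse power2_eq_square)
qed

text \<open>In the notation of \<open>det_conjugate\<close> the condition is \<open>\<beta> d = \<beta> a\<close>. If \<open>\<beta>\<close> has values \<open>\<plusminus>1\<close>, this is
  \<open>\<beta> (a * d) = 1\<close>, that is \<open>\<beta> l ^ r = 1\<close>.\<close>

lemma admissible_form:
  assumes X: "form_family X" and r: "r \<le> n" and sq: "\<forall>x. x \<noteq> 0 \<longrightarrow> (\<beta> x)\<^sup>2 = 1"
    and pow: "\<And>l. factor_ok X l \<Longrightarrow> \<beta> l ^ r = 1"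
  shows "admissible (weyl X n r)"
proof (rule admissibleI)
  fix A B D A' B' D' :: "'a mat"
  assume c: "A \<in> carrier_mat n n" "B \<in> carrier_mat n n" "D \<in> carrier_mat n n"
    "A' \<in> carrier_mat n n" "B' \<in> carrier_mat n n" "D' \<in> carrier_mat n n"
    and p: "four_block_mat A B (0\<^sub>m n n) D \<in> P_set X n" and dets: "det D \<noteq> 0" "det D' \<noteq> 0"
    and eq: "four_block_mat A B (0\<^sub>m n n) D * weyl X n r = weyl X n r * four_block_mat A' B' (0\<^sub>m n n) D'"
  obtain l where l: "factor_ok X l" "D\<^sup>T * A = l \<cdot>\<^sub>m 1\<^sub>m n"
    using P_set_G_set[OF p] unfolding G_set_form_iff[OF X] form_upper_iff[OF c(1-3)] by blast
  obtain a d e where ade: "det D = d * e" "det D' = a * e" "a * d = l ^ r"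
    using det_conjugate[OF c eq l(2) r] .
  have nz: "a \<noteq> 0" "d \<noteq> 0" "e \<noteq> 0" "l \<noteq> 0" using ade dets l by (auto simp: factor_ok_def)
  have "\<beta> a * \<beta> d = 1"
    using pow[OF l(1)] nz beta_mult[of a d] by (simp add: ade(3) beta_power)
  moreover have "\<beta> a * \<beta> a = 1" using sq nz by (simp add: power2_eq_square)
  ultimately have "\<beta> d = \<beta> a" using beta_nonzero[OF nz(1)] by (metis mult_left_cancel)
  then show "\<beta> (det D) = \<beta> (det D')" unfolding ade using nz by (simp add: beta_mult)
qed

lemma torus_in_P_set:
  fixes a d :: "nat \<Rightarrow> 'a"
  assumes "\<And>i. i < n \<Longrightarrow> d i * a i = 1"
  shows "torus n a d \<in> P_set X n"
proof (cases X rule: family_cases)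
  case 3
  have "factor_ok X (1 :: 'a)" by (simp add: factor_ok_def)
  then show ?thesis by (rule torus_in_P_set_form[OF 3]) (rule assms)
next
  case 1
  have "a i \<noteq> 0 \<and> d i \<noteq> 0" if "i < n" for i using assms[OF that] by auto
  then show ?thesis unfolding 1 by (intro torus_in_P_set_GL) auto
next
  case 2
  have "a i \<noteq> 0 \<and> d i \<noteq> 0" if "i < n" for i using assms[OF that] by auto
  then have "torus n a d \<in> P_set GL n" by (intro torus_in_P_set_GL) auto
  moreover have "det (torus n a d) = (\<Prod>i<n. d i * a i)" by (simp add: det_torus prod.distrib mult.commute)
  then have "det (torus n a d) = 1" using assms by simp
  ultimately show ?thesis unfolding 2 P_set_SL_iff by simp
qed

text \<open>The torus element with first pair of entries \<open>(1 / x, x)\<close> lies in each of the six groups, and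
  exchanging the pair changes \<open>\<beta> x\<close> to its inverse.\<close>

lemma not_admissible_if_square_nontrivial:
  assumes r: "r \<ge> 1" and x: "x \<noteq> 0" "(\<beta> x)\<^sup>2 \<noteq> 1"
  shows "\<not> admissible (weyl X n r)"
proof -
  define t where "t y i = (if i = 0 then y else 1)" for y :: 'a and i :: nat
  have prod_t: "(\<Prod>i<n. t y i) = y" for y using n by (simp add: t_def prod.delta)
  have tt: "t x i * t (inverse x) i = 1" "t (inverse x) i * t x i = 1" for i using x by (simp_all add: t_def)
  have swap: "(\<lambda>i. if i < r then t x i else t (inverse x) i) = t x"
    "(\<lambda>i. if i < r then t (inverse x) i else t x i) = t (inverse x)"
    using r by (auto simp: t_def fun_eq_iff)
  have "\<beta> x \<noteq> \<beta> (inverse x)"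
    unfolding beta_inverse[OF x(1)]
    using x(2) beta_nonzero[OF x(1)] by (metis power2_eq_square right_inverse)
  then show ?thesis
    using not_admissibleI[of "t (inverse x)" "t x" r] torus_in_P_set tt
    unfolding swap prod_t by blast
qed

text \<open>The two halves of the torus are independent, so \<open>x\<close> can be exchanged for \<open>1\<close>.\<close>

lemma not_admissible_GL:
  assumes X: "X = GL" and r: "r \<ge> 1" and x: "x \<noteq> 0" "\<beta> x \<noteq> 1"
  shows "\<not> admissible (weyl X n r)"
proof -
  define t where "t i = (if i = 0 then x else 1)" for i :: nat
  have prod_t: "(\<Prod>i<n. t i) = x" using n by (simp add: t_def prod.delta)
  have t0: "t i \<noteq> 0" for i using x by (simp add: t_def)
  have swap: "(\<lambda>i. if i < r then 1 else t i) = (\<lambda>_. 1)" using r by (auto simp: t_def fun_eq_iff)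
  have P: "torus n (\<lambda>_. 1) t \<in> P_set X n" "torus n (\<lambda>i. if i < r then t i else 1) (\<lambda>_. 1) \<in> P_set X n"
    unfolding X by (rule torus_in_P_set_GL; simp add: t0)+
  show ?thesis
    by (rule not_admissibleI[of "\<lambda>_. 1" t r, unfolded swap, OF P]) (simp add: prod_t x beta_one)
qed

text \<open>For \<open>r < n\<close> the determinant can be corrected in the last coordinate, which is not exchanged.\<close>

lemma not_admissible_SL:
  assumes X: "X = SL" and r: "r \<ge> 1" "r < n" and x: "x \<noteq> 0" "\<beta> x \<noteq> 1"
  shows "\<not> admissible (weyl X n r)"
proof -
  define t where "t i = (if i = 0 then x else 1)" for i :: nat
  \<comment> \<open>The entries \<open>x\<close> and \<open>1 / x\<close> sit in different halves, at an exchanged and at a fixed coordinate.\<close>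
  define s where "s i = (if i = n - 1 then inverse x else 1)" for i :: nat
  have prods: "(\<Prod>i<n. t i) = x" "(\<Prod>i<n. s i) = inverse x"
    using n by (simp_all add: t_def s_def prod.delta)
  have nz: "t i \<noteq> 0" "s i \<noteq> 0" for i using x by (simp_all add: t_def s_def)
  have swap: "(\<lambda>i. if i < r then s i else t i) = (\<lambda>_. 1)" using r by (auto simp: t_def s_def fun_eq_iff)
  have swap': "(\<lambda>i. if i < r then t i else s i) = (\<lambda>i. t i * s i)" using r by (auto simp: t_def s_def fun_eq_iff)
  have "torus n s t \<in> P_set GL n" "torus n (\<lambda>i. t i * s i) (\<lambda>_. 1) \<in> P_set GL n"
    by (rule torus_in_P_set_GL; simp add: nz)+
  then have P: "torus n s t \<in> P_set X n" "torus n (\<lambda>i. t i * s i) (\<lambda>_. 1) \<in> P_set X n"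
    unfolding X P_set_SL_iff using x by (simp_all add: det_torus prod.distrib prods)
  show ?thesis
    by (rule not_admissibleI[of s t r, unfolded swap swap', OF P]) (simp add: prods x beta_one)
qed

text \<open>The torus element with all upper entries \<open>x\<close> and all lower entries \<open>1\<close> has multiplier \<open>x\<close>; exchanging
  \<open>r\<close> pairs changes the determinant of the lower half from \<open>1\<close> to \<open>x ^ r\<close>, and \<open>\<beta> (x ^ r) = \<beta> x\<close>.\<close>

lemma not_admissible_similitude:
  assumes X: "X \<in> {GO, GSp}" and r: "odd r" "r \<le> n" and x: "x \<noteq> 0" "\<beta> x \<noteq> 1"
    and sq: "\<forall>x. x \<noteq> 0 \<longrightarrow> (\<beta> x)\<^sup>2 = 1"
  shows "\<not> admissible (weyl X n r)"
proof -
  have form: "form_family X" and ok: "factor_ok X x" using X x by (auto simp: form_family_def factor_ok_def)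
  have P: "torus n (\<lambda>_. x) (\<lambda>_. 1) \<in> P_set X n"
    "torus n (\<lambda>i. if i < r then 1 else x) (\<lambda>i. if i < r then x else 1) \<in> P_set X n"
    by (rule torus_in_P_set_form[OF form ok]; simp)+
  have "(\<Prod>i<n. if i < r then x else 1) = (\<Prod>i<r. x)"
    using r by (intro prod.mono_neutral_cong_right) auto
  then have prod: "(\<Prod>i<n. if i < r then x else 1) = x ^ r" by simp
  obtain k where k: "r = Suc (2 * k)" using r(1) by (metis oddE Suc_eq_plus1)
  have "\<beta> (x ^ r) = \<beta> x ^ r" by (rule beta_power[OF x(1)])
  also have "\<dots> = \<beta> x * ((\<beta> x)\<^sup>2) ^ k" unfolding k by (simp only: power_Suc power_mult)
  finally have "\<beta> (x ^ r) = \<beta> x" using sq x by simp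
  then have "\<beta> (\<Prod>i<n. 1) \<noteq> \<beta> (\<Prod>i<n. if i < r then x else 1)"
    unfolding prod using x(2) by (simp add: beta_one)
  then show ?thesis by (rule not_admissibleI[of "\<lambda>_. x" "\<lambda>_. 1" r, OF P])
qed

theorem dim_End_siegel: "op_space.dim (End_G (G_grp X n) V) = card {r \<in> {..n}. admissible (weyl X n r)}"
proof (rule dim_End_Ind)
  show "weyl X n r \<in> carrier (G_grp X n)" for r using weyl_G_set by simp
  show "\<exists>r\<in>{..n}. \<exists>p\<in>P_set X n. \<exists>q\<in>P_set X n. g = p \<otimes>\<^bsub>G_grp X n\<^esub> weyl X n r \<otimes>\<^bsub>G_grp X n\<^esub> q"
    if "g \<in> carrier (G_grp X n)" for g
    using double_cosets_cover[OF n, of g X] that by auto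
  show "i = j" if "i \<in> {..n}" "j \<in> {..n}" "p \<in> P_set X n" "q \<in> P_set X n"
    "weyl X n j = p \<otimes>\<^bsub>G_grp X n\<^esub> weyl X n i \<otimes>\<^bsub>G_grp X n\<^esub> q" for i j p q
    using double_cosets_disjoint[of p X n q i j] that by simp
qed simp

lemma admissible_ranks:
  "{r \<in> {..n}. admissible (weyl X n r)} =
    (if \<forall>x. x \<noteq> 0 \<longrightarrow> \<beta> x = 1 then {..n}
     else if \<forall>x. x \<noteq> 0 \<longrightarrow> (\<beta> x)\<^sup>2 = 1 then
       (if X = GL then {0} else if X = SL then {0, n} else if X \<in> {Ort, Sp} then {..n} else {r \<in> {..n}. even r})
     else {0})"
proof (cases "\<forall>x. x \<noteq> 0 \<longrightarrow> \<beta> x = 1")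
  case True
  then show ?thesis using admissible_if_trivial by auto
next
  case nontrivial: False
  then obtain x where x: "x \<noteq> 0" "\<beta> x \<noteq> 1" by blast
  show ?thesis
  proof (cases "\<forall>x. x \<noteq> 0 \<longrightarrow> (\<beta> x)\<^sup>2 = 1")
    case False
    then obtain y where y: "y \<noteq> 0" "(\<beta> y)\<^sup>2 \<noteq> 1" by blast
    have "r = 0" if "admissible (weyl X n r)" for r
      using not_admissible_if_square_nontrivial[OF _ y, of r] that by (cases r) auto
    then have "{r \<in> {..n}. admissible (weyl X n r)} = {0}" using admissible_zero by auto
    then show ?thesis using nontrivial False by (simp only: if_False)
  next
    case sq: True
    have *: "{r \<in> {..n}. admissible (weyl X n r)} =
       (if X = GL then {0} else if X = SL then {0, n} else if X \<in> {Ort, Sp} then {..n} else {r \<in> {..n}. even r})"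
    proof (cases X rule: family_cases)
      case 1
      have "r = 0" if "admissible (weyl X n r)" for r
        using not_admissible_GL[OF 1 _ x, of r] that by (cases r) auto
      then show ?thesis using 1 admissible_zero by auto
    next
      case 2
      have "r = 0 \<or> r = n" if "admissible (weyl X n r)" "r \<le> n" for r
        using not_admissible_SL[OF 2 _ _ x, of r] that
        by (metis One_nat_def Suc_leI le_neq_implies_less neq0_conv)
      then show ?thesis using 2 admissible_zero admissible_SL_top[OF 2 sq] by auto
    next
      case 3
      show ?thesis
      proof (cases "X \<in> {Ort, Sp}")
        case True
        have "admissible (weyl X n r)" if "r \<le> n" for r
          by (rule admissible_form[OF 3 that sq]) (use True in \<open>auto simp: factor_ok_def beta_one\<close>)
        then show ?thesis using True by auto
      next
        case False
        then have GO: "X \<in> {GO, GSp}" using 3 by (auto simp: form_family_def)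
        have "admissible (weyl X n r)" if r: "r \<le> n" "even r" for r
        proof (rule admissible_form[OF 3 r(1) sq])
          fix l :: 'a assume "factor_ok X l"
          then have "(\<beta> l)\<^sup>2 = 1" using sq by (simp add: factor_ok_def)
          then show "\<beta> l ^ r = 1" using r(2) by (auto elim!: evenE simp: power_mult)
        qed
        moreover have "even r" if "admissible (weyl X n r)" "r \<le> n" for r
          using not_admissible_similitude[OF GO _ that(2) x sq] that(1) by blast
        ultimately show ?thesis using GO by auto
      qed
    qed
    show ?thesis unfolding * if_not_P[OF nontrivial] if_P[OF sq] ..
  qed
qed

end

section \<open>The dimension formula\<close>

lemma card_even_le: "card {r. r \<le> n \<and> even r} = (n + 2) div 2" for n :: nat
proof -
  have "{r. r \<le> n \<and> even r} = (\<lambda>k. 2 * k) ` {..n div 2}"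
    by (auto elim!: evenE)
  then have "card {r. r \<le> n \<and> even r} = card {..n div 2}"
    by (simp add: card_image inj_on_def)
  then show ?thesis by simp
qed

theorem proposition2p3p1:
  fixes X :: group_family
    and n :: nat
    and \<chi> :: "'a::{field,finite} mat \<Rightarrow> complex"
    and \<alpha> \<beta> :: "'a \<Rightarrow> complex"
  assumes "odd CARD('a)" and "\<not> 3 dvd CARD('a)" and "n \<ge> 1"
    and "\<chi> \<in> hom (P_grp X n) mult_grp"
    and "\<alpha> \<in> hom mult_grp mult_grp"
    and "\<beta> \<in> hom mult_grp mult_grp"
    and "\<forall>p \<in> P_set X n. \<chi> p = \<alpha> (multiplier X n p) * \<beta> (chi_det n p)"
  shows "vector_space.dim opscale (End_G (G_grp X n) (Ind (G_grp X n) (P_set X n) \<chi>)) =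
      (if \<forall>x. x \<noteq> 0 \<longrightarrow> \<beta> x = 1 then n + 1
       else if (\<forall>x. x \<noteq> 0 \<longrightarrow> (\<beta> x)\<^sup>2 = 1) \<and> X = SL then 2
       else if (\<forall>x. x \<noteq> 0 \<longrightarrow> (\<beta> x)\<^sup>2 = 1) \<and> X \<in> {Ort, Sp} then n + 1
       else if (\<forall>x. x \<noteq> 0 \<longrightarrow> (\<beta> x)\<^sup>2 = 1) \<and> X \<in> {GO, GSp} then (n + 2) div 2
       else 1)
    \<and> (\<not> (\<forall>x. x \<noteq> 0 \<longrightarrow> (\<beta> x)\<^sup>2 = 1) \<longrightarrow>
         irreducible_rep (G_grp X n) (Ind (G_grp X n) (P_set X n) \<chi>))"
proof -
  interpret siegel_character X n \<chi> \<alpha> \<beta>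
    using assms by unfold_locales
  note dim = dim_End_siegel[unfolded admissible_ranks]
  have count: "card (if T then {..n} else if S then
       (if X = GL then {0} else if X = SL then {0, n} else if X \<in> {Ort, Sp} then {..n} else {r \<in> {..n}. even r})
     else {0}) = (if T then n + 1 else if S \<and> X = SL then 2 else if S \<and> X \<in> {Ort, Sp} then n + 1
       else if S \<and> X \<in> {GO, GSp} then (n + 2) div 2 else 1)" for T S
    using \<open>n \<ge> 1\<close> by (cases X; cases T; cases S) (simp_all add: card_even_le)
  show ?thesis
  proof (intro conjI impI)
    show "op_space.dim (End_G (G_grp X n) (Ind (G_grp X n) (P_set X n) \<chi>)) =
      (if \<forall>x. x \<noteq> 0 \<longrightarrow> \<beta> x = 1 then n + 1
       else if (\<forall>x. x \<noteq> 0 \<longrightarrow> (\<beta> x)\<^sup>2 = 1) \<and> X = SL then 2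
       else if (\<forall>x. x \<noteq> 0 \<longrightarrow> (\<beta> x)\<^sup>2 = 1) \<and> X \<in> {Ort, Sp} then n + 1
       else if (\<forall>x. x \<noteq> 0 \<longrightarrow> (\<beta> x)\<^sup>2 = 1) \<and> X \<in> {GO, GSp} then (n + 2) div 2
       else 1)"
      unfolding dim by (rule count)
    assume nsq: "\<not> (\<forall>x. x \<noteq> 0 \<longrightarrow> (\<beta> x)\<^sup>2 = 1)"
    then have "\<not> (\<forall>x. x \<noteq> 0 \<longrightarrow> \<beta> x = 1)" by auto
    then have "op_space.dim (End_G (G_grp X n) V) = 1"
      unfolding dim by (simp only: if_not_P[OF nsq] if_not_P) simp
    then show "irreducible_rep (G_grp X n) (Ind (G_grp X n) (P_set X n) \<chi>)"
      by (rule irreducible_if_dim_End_1)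
  qed
qed

end
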